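(* For every integer $n>1$, the number $E_n$ of simple series-parallel matroids of rank $n$ on the ground set $[2n-2]=\{1,\dots,2n-2\}$ is $$E_n=(2n-1)^{n-2}\cdot (2n-3)!! - \frac{(n-2)(n-1)^{n-5}\cdot (2n-1)!}{3\cdot (n-2)!}-\frac{(n+1)(n-1)^{n-3}\cdot (2n-3)!}{3\cdot (n-1)!}.$$
   Context: A series-parallel matroid is the graphic matroid either of a single non-loop edge, or of a graph obtained from a pair of parallel edges (two vertices joined by two edges) by repeatedly either adding an edge parallel to an existing one or subdividing an edge. In particular series-parallel matroids are connected; equivalently, they are the nonempty connected loopless matroids having no minor isomorphic to the graphic matroid of the complete graph $K_4$ or to the uniform matroid $U_{2,4}$ of rank two on four elements. Matroids are counted as labelled matroids on the given ground set (not up to isomorphism). $m!!$ denotes the double factorial ($1!!=1$, $m!!=m\cdot(m-2)!!$), and powers with negative exponents are rational numbers. *)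

theory Defs
  imports Complex_Main
begin

locale matroid =
  fixes E :: "'a set" and \<I> :: "'a set set"
  assumes finite_ground: "finite E"
    and indep_subset_ground: "X \<in> \<I> \<Longrightarrow> X \<subseteq> E"
    and indep_empty: "{} \<in> \<I>"
    and indep_subset: "X \<in> \<I> \<Longrightarrow> Y \<subseteq> X \<Longrightarrow> Y \<in> \<I>"
    and indep_augment: "X \<in> \<I> \<Longrightarrow> Y \<in> \<I> \<Longrightarrow> card X < card Y \<Longrightarrow> \<exists>y\<in>Y - X. insert y X \<in> \<I>"

definition matroid_rank :: "'a set set \<Rightarrow> nat" where
  "matroid_rank \<I> = Max (card ` \<I>)"

definition matroid_circuit :: "'a set \<Rightarrow> 'a set set \<Rightarrow> 'a set \<Rightarrow> bool" where
  "matroid_circuit E \<I> C \<longleftrightarrow> C \<subseteq> E \<and> C \<notin> \<I> \<and> (\<forall>D. D \<subset> C \<longrightarrow> D \<in> \<I>)"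

text \<open>No circuit of size one (a loop) or two (a parallel pair); the empty set is never a circuit.\<close>

definition simple_matroid :: "'a set \<Rightarrow> 'a set set \<Rightarrow> bool" where
  "simple_matroid E \<I> \<longleftrightarrow> (\<forall>C. matroid_circuit E \<I> C \<longrightarrow> card C > 2)"

text \<open>
  A multigraph is given by a vertex set \<open>V\<close>, an edge set \<open>E\<close> and a map \<open>ends\<close> sending each edge
  to its set of endpoints (a singleton for a loop); values of \<open>ends\<close> outside \<open>E\<close> are irrelevant.
  In a cycle, the edge \<open>es ! i\<close> joins \<open>vs ! i\<close> to its cyclic successor, so that a loop is a
  cycle of length one and a pair of parallel edges a cycle of length two.
\<close>

definition graph_cycle :: "('e \<Rightarrow> 'v set) \<Rightarrow> 'v list \<Rightarrow> 'e list \<Rightarrow> bool" where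
  "graph_cycle ends vs es \<longleftrightarrow>
     es \<noteq> [] \<and> length vs = length es \<and> distinct vs \<and> distinct es \<and>
     (\<forall>i<length es. ends (es ! i) = {vs ! i, vs ! (Suc i mod length es)})"

text \<open>The independent sets of the graphic matroid are the edge sets of forests.\<close>

definition graphic_indep :: "'e set \<Rightarrow> ('e \<Rightarrow> 'v set) \<Rightarrow> 'e set set" where
  "graphic_indep E ends = {F. F \<subseteq> E \<and> \<not> (\<exists>vs es. graph_cycle ends vs es \<and> set es \<subseteq> F)}"

text \<open>
  When an edge \<open>e\<close> is subdivided, one of its two halves keeps the label \<open>e\<close> and the other one
  gets the fresh label \<open>f\<close>. As \<open>u\<close> and \<open>v\<close> may be exchanged, either half can be the one keeping
  the label, so every edge labelling of the resulting graph is obtained.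
\<close>

inductive sp_graph :: "'v set \<Rightarrow> 'e set \<Rightarrow> ('e \<Rightarrow> 'v set) \<Rightarrow> bool" where
  parallel_pair:
    "u \<noteq> v \<Longrightarrow> e \<noteq> f \<Longrightarrow> ends e = {u, v} \<Longrightarrow> ends f = {u, v} \<Longrightarrow> sp_graph {u, v} {e, f} ends"
| add_parallel:
    "sp_graph V E ends \<Longrightarrow> e \<in> E \<Longrightarrow> f \<notin> E \<Longrightarrow> sp_graph V (insert f E) (ends(f := ends e))"
| subdivide:
    "sp_graph V E ends \<Longrightarrow> e \<in> E \<Longrightarrow> ends e = {u, v} \<Longrightarrow> f \<notin> E \<Longrightarrow> w \<notin> V \<Longrightarrow>
     sp_graph (insert w V) (insert f E) (ends(e := {u, w}, f := {w, v}))"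

definition single_edge_graph :: "'v set \<Rightarrow> 'e set \<Rightarrow> ('e \<Rightarrow> 'v set) \<Rightarrow> bool" where
  "single_edge_graph V E ends \<longleftrightarrow> (\<exists>u v e. u \<noteq> v \<and> V = {u, v} \<and> E = {e} \<and> ends e = {u, v})"

text \<open>All graphs here are finite, so it is no restriction to take natural numbers as vertices.\<close>

definition series_parallel_matroid :: "'a set \<Rightarrow> 'a set set \<Rightarrow> bool" where
  "series_parallel_matroid E \<I> \<longleftrightarrow>
     (\<exists>(V :: nat set) ends. (single_edge_graph V E ends \<or> sp_graph V E ends) \<and>
        \<I> = graphic_indep E ends)"

fun double_fact :: "nat \<Rightarrow> nat" where
  "double_fact 0 = 1"
| "double_fact (Suc 0) = 1"
| "double_fact (Suc (Suc m)) = Suc (Suc m) * double_fact m"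

text \<open>
  A labelled matroid on a fixed ground set is determined by its family of independent sets, so
  these families are what is counted.
\<close>

definition simple_sp_matroids :: "nat set \<Rightarrow> nat \<Rightarrow> nat set set set" where
  "simple_sp_matroids E r =
     {\<I>. matroid E \<I> \<and> simple_matroid E \<I> \<and> series_parallel_matroid E \<I> \<and> matroid_rank \<I> = r}"

end

theory Submission
  imports Defs "HOL-Library.Infinite_Set" "HOL-Computational_Algebra.Formal_Power_Series"
begin

text \<open>
  Fix an element \<open>e\<close> of the ground set. Deleting \<open>e\<close> from a series-parallel graph leaves a two-terminal
  network, which is described by a binary series/parallel tree on the remaining elements; the
  matroid determines which sets of edges connect the terminals, and this read-once Boolean function
  determines the tree up to commutativity and associativity. Hence simple series-parallel matroids
  correspond to trees in a suitable normal form.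

  For a simple tree \<open>2 * rank - size\<close> is at least 1, and at least 2 if the root has no parallel
  leaf; the matroids to be counted are those with a root of the latter kind and value 3, one above
  the minimum. Thus only the two lowest layers of the generating function in this statistic
  matter. The lowest layer is the series \<open>c = x exp (c^2 / 2)\<close> of rooted triangular cacti, and the
  next one, \<open>q\<close>, satisfies \<open>x q = c' c^2 - x (c' c + c' c^3 / 3)\<close>. The coefficients of powers
  of \<open>c\<close> follow from the differential equation \<open>x c' (1 - c^2) = c\<close>.
\<close>

unbundle fps_syntax

section \<open>Forests and degrees\<close>

text \<open>Graphs and trees are compared without drawing a tree as a graph: on both sides the
  independent sets change by the same rule when one element is extended in parallel or in series,
  and induction along these extensions identifies the two families. For cycles given as lists this
  rule would be awkward to verify; a criterion in terms of vertex degrees makes it local. Any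
  element can serve as \<open>e\<close>, because the cyclic arrangement of networks around a root
  edge can be opened at any place without changing the forests. The statistic closes up after few
  classes: it is additive at series nodes and additive up to -2 at parallel nodes, and the lower
  bounds for the children leave only a handful of ways to split a small value. Since a normal form
  binds the smallest label to the left child, a product of classes becomes an equation C' = P' R
  between generating functions. The exponential in the equation of \<open>c\<close> is used only
  through differential equations; the one for \<open>c\<close> relates the coefficients of c^k and
  c^(k+2) at the same index, which takes the place of Lagrange inversion.\<close>

definition degree :: "('e \<Rightarrow> 'v set) \<Rightarrow> 'e set \<Rightarrow> 'v \<Rightarrow> nat" where
  "degree ends C v = card {x \<in> C. v \<in> ends x}"

text \<open>In the usual terminology a path, since the vertices are distinct. There is no
  wrap-around as in \<open>graph_cycle\<close>, hence one more vertex than edges.\<close>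

definition trail :: "('e \<Rightarrow> 'v set) \<Rightarrow> 'v list \<Rightarrow> 'e list \<Rightarrow> bool" where
  "trail ends vs es \<longleftrightarrow> length vs = Suc (length es) \<and> distinct vs \<and>
     (\<forall>i<length es. ends (es ! i) = {vs ! i, vs ! Suc i})"

lemma trail_distinct_edges:
  assumes "trail ends vs es"
  shows "distinct es"
proof -
  have "es ! i \<noteq> es ! j" if "i < j" "j < length es" for i j
  proof
    assume "es ! i = es ! j"
    then have "{vs ! i, vs ! Suc i} = {vs ! j, vs ! Suc j}"
      using assms that unfolding trail_def by (metis order.strict_trans)
    moreover have "vs ! i \<noteq> vs ! j" "vs ! i \<noteq> vs ! Suc j"
      using assms that unfolding trail_def by (auto simp: nth_eq_iff_index_eq)
    ultimately show False by blast
  qed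
  then show ?thesis
    unfolding distinct_conv_nth by (metis linorder_neqE_nat)
qed

text \<open>Longest path argument: the first vertex of a longest path has a second edge in
  \<open>C\<close>, whose other end lies on the path by maximality, and this closes a cycle.\<close>

lemma degree_ne_1_imp_cycle:
  assumes C: "finite C" "C \<noteq> {}" and two: "\<And>x. x \<in> C \<Longrightarrow> card (ends x) = 2"
    and deg: "\<And>v. degree ends C v \<noteq> 1"
  shows "\<exists>vs es. graph_cycle ends vs es \<and> set es \<subseteq> C"
proof -
  define P where "P k \<longleftrightarrow> (\<exists>vs es. trail ends vs es \<and> set es \<subseteq> C \<and> length es = k)" for k
  have P1: "P 1"
  proof -
    obtain x where x: "x \<in> C" using C by blast
    obtain u v where "ends x = {u, v}" "u \<noteq> v" using two[OF x] by (auto simp: card_2_iff)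
    then have "trail ends [u, v] [x]" by (simp add: trail_def)
    then show ?thesis unfolding P_def using x by (intro exI[of _ "[u, v]"] exI[of _ "[x]"]) simp
  qed
  have bound: "k \<le> card C" if "P k" for k
    using that C(1) unfolding P_def
    by (metis card_mono distinct_card trail_distinct_edges)
  obtain k where k: "P k" "\<And>j. P j \<Longrightarrow> j \<le> k"
    using GreatestI_nat[of P 1 "card C"] Greatest_le_nat[of P _ "card C"] P1 bound by metis
  then have "k > 0" using k(2)[OF P1] by linarith
  from k obtain vs es where t: "trail ends vs es" "set es \<subseteq> C" "length es = k"
    unfolding P_def by blast
  have len: "length vs = Suc k" and dv: "distinct vs"
    and en: "\<And>i. i < k \<Longrightarrow> ends (es ! i) = {vs ! i, vs ! Suc i}"
    using t by (auto simp: trail_def)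
  let ?v = "vs ! 0"
  have e0: "es ! 0 \<in> {x \<in> C. ?v \<in> ends x}" using t \<open>k > 0\<close> en[of 0] by auto
  have "\<exists>g. g \<in> C \<and> ?v \<in> ends g \<and> g \<noteq> es ! 0"
  proof (rule ccontr)
    assume "\<not> ?thesis"
    then have "{x \<in> C. ?v \<in> ends x} = {es ! 0}" using e0 by blast
    then show False using deg[of ?v] by (simp add: degree_def)
  qed
  then obtain g where g: "g \<in> C" "?v \<in> ends g" "g \<noteq> es ! 0" by blast
  obtain x where x: "ends g = {x, ?v}" "x \<noteq> ?v"
    using two[OF g(1)] g(2) unfolding card_2_iff by (metis insert_commute insertE singletonD)
  have "x \<in> set vs"
  proof (rule ccontr)
    assume "x \<notin> set vs"
    then have "trail ends (x # vs) (g # es)"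
      using t x unfolding trail_def by (auto simp: nth_Cons split: nat.splits)
    then have "P (Suc k)" unfolding P_def using t g by (intro exI[of _ "x # vs"] exI[of _ "g # es"]) simp
    then show False using k(2) by fastforce
  qed
  then obtain j where j: "j < Suc k" "vs ! j = x" using len by (metis in_set_conv_nth)
  have "j \<noteq> 0" using j x by (metis)
  have gni: "g \<noteq> es ! i" if "i < k" for i
  proof
    assume *: "g = es ! i"
    then have "i \<noteq> 0" using g by metis
    have "?v \<in> {vs ! i, vs ! Suc i}" using * en[OF that] g(2) by simp
    then show False using dv len that \<open>i \<noteq> 0\<close> by (auto simp: nth_eq_iff_index_eq)
  qed
  \<comment> \<open>The path from its start to \<open>x = vs ! j\<close>, closed up by
    \<open>g\<close>; for \<open>j = 1\<close> this is a pair of parallel edges.\<close>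
  let ?vs = "take (Suc j) vs" and ?es = "take j es @ [g]"
  have "graph_cycle ends ?vs ?es"
    unfolding graph_cycle_def
  proof (intro conjI allI impI)
    show "length ?vs = length ?es" using len j t by simp
    show "distinct ?vs" using dv by simp
    have "g \<notin> set (take j es)"
    proof
      assume "g \<in> set (take j es)"
      then obtain i where "i < j" "i < length es" "es ! i = g" by (auto simp: in_set_conv_nth)
      then show False using gni t(3) by blast
    qed
    then show "distinct ?es" using trail_distinct_edges[OF t(1)] by simp
    fix i assume i: "i < length ?es"
    then have "i \<le> j" using t j by simp
    have lj: "length ?es = Suc j" using t j by simp
    show "ends (?es ! i) = {?vs ! i, ?vs ! (Suc i mod length ?es)}"
    proof (cases "i = j")
      case True
      then show ?thesis using x j lj t by (auto simp: nth_append)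
    next
      case False
      then have "i < j" using \<open>i \<le> j\<close> by simp
      then show ?thesis unfolding lj using t j en[of i] by (simp add: nth_append)
    qed
  qed simp
  moreover have "set ?es \<subseteq> C" using t g set_take_subset[of j es] by auto
  ultimately show ?thesis by blast
qed

text \<open>Each end of an edge of the cycle is shared with the edge before or after it. This is a
  different edge because \<open>two\<close> excludes cycles of length one.\<close>

lemma cycle_imp_degree_ne_1:
  assumes cyc: "graph_cycle ends vs es" and two: "\<And>x. x \<in> set es \<Longrightarrow> card (ends x) = 2"
  shows "degree ends (set es) v \<noteq> 1"
proof
  let ?n = "length es"
  assume "degree ends (set es) v = 1"
  then obtain x where x: "{x \<in> set es. v \<in> ends x} = {x}"
    unfolding degree_def by (auto simp: card_1_singleton_iff)
  have en: "ends (es ! i) = {vs ! i, vs ! (Suc i mod ?n)}" if "i < ?n" for i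
    using cyc that by (auto simp: graph_cycle_def)
  have de: "distinct es" and n0: "?n > 0" using cyc by (auto simp: graph_cycle_def)
  have "?n \<noteq> 1"
  proof
    assume "?n = 1"
    then have "ends (es ! 0) = {vs ! 0}" using en[of 0] by simp
    then show False using two[of "es ! 0"] n0 by simp
  qed
  then have n: "?n > 1" using n0 by linarith
  have x': "x \<in> set es" "v \<in> ends x" using x by auto
  then obtain i where i: "i < ?n" "es ! i = x" by (meson in_set_conv_nth)
  obtain j where j: "j < ?n" "j \<noteq> i" "v \<in> ends (es ! j)"
  proof (cases "v = vs ! i")
    case True
    show ?thesis
    proof (cases i)
      case 0
      then show ?thesis using that[of "?n - 1"] n True Suc_diff_1[OF n0] en[of "?n - 1"] by simp
    next
      case (Suc k)
      then show ?thesis using that[of k] i True en[of k] by simp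
    qed
  next
    case False
    then have v: "v = vs ! (Suc i mod ?n)" using x' i en[of i] by auto
    have "Suc i mod ?n \<noteq> i"
      using i n by (cases "Suc i = ?n") auto
    then show ?thesis using that[of "Suc i mod ?n"] n0 en[of "Suc i mod ?n"] v by simp
  qed
  then have "es ! j = x" using x by (metis (mono_tags, lifting) mem_Collect_eq nth_mem singletonD)
  then show False using i j de by (metis nth_eq_iff_index_eq)
qed

text \<open>Endpoint sets of size two leave no room for loops. This is the invariant of
  \<open>sp_graph\<close> under which degrees detect forests.\<close>

definition multigraph :: "'v set \<Rightarrow> 'e set \<Rightarrow> ('e \<Rightarrow> 'v set) \<Rightarrow> bool" where
  "multigraph V E ends \<longleftrightarrow> finite V \<and> finite E \<and> (\<forall>x\<in>E. ends x \<subseteq> V \<and> card (ends x) = 2)"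

lemma sp_graph_multigraph: "sp_graph V E ends \<Longrightarrow> multigraph V E ends"
proof (induction rule: sp_graph.induct)
  case (subdivide V E ends e u v f w)
  then have "u \<in> V" "v \<in> V" by (auto simp: multigraph_def)
  then have "w \<noteq> u" "w \<noteq> v" using subdivide by auto
  then show ?case using subdivide by (auto simp: multigraph_def card_insert_if)
qed (auto simp: multigraph_def)

text \<open>Every nonempty subset of a forest has a vertex of degree one, and a cycle has none. This
  replaces the existence of cyclic lists by a count that is easily followed through a change of
  \<open>ends\<close>.\<close>

lemma graphic_indep_iff:
  assumes "multigraph V E ends"
  shows "F \<in> graphic_indep E ends \<longleftrightarrow>
    F \<subseteq> E \<and> (\<forall>C\<subseteq>F. C \<noteq> {} \<longrightarrow> (\<exists>v. degree ends C v = 1))"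
proof -
  have "(\<exists>vs es. graph_cycle ends vs es \<and> set es \<subseteq> F) \<longleftrightarrow>
      (\<exists>C\<subseteq>F. C \<noteq> {} \<and> (\<forall>v. degree ends C v \<noteq> 1))" (is "?L \<longleftrightarrow> ?R") if F: "F \<subseteq> E"
  proof
    assume ?L
    then obtain vs es where c: "graph_cycle ends vs es" "set es \<subseteq> F" by blast
    have "card (ends x) = 2" if "x \<in> set es" for x
      using that c F assms by (auto simp: multigraph_def)
    then have "\<forall>v. degree ends (set es) v \<noteq> 1"
      using cycle_imp_degree_ne_1[OF c(1)] by blast
    moreover have "set es \<noteq> {}" using c by (auto simp: graph_cycle_def)
    ultimately show ?R using c by blast
  next
    assume ?R
    then obtain C where C: "C \<subseteq> F" "C \<noteq> {}" "\<And>v. degree ends C v \<noteq> 1" by blast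
    have "finite C" using C F assms by (meson finite_subset multigraph_def)
    then have "\<exists>vs es. graph_cycle ends vs es \<and> set es \<subseteq> C"
      using degree_ne_1_imp_cycle[of C ends] C F assms unfolding multigraph_def by blast
    then show ?L using C by blast
  qed
  then show ?thesis unfolding graphic_indep_def by blast
qed

text \<open>The edges \<open>e\<close> and \<open>f\<close> cannot both occur, and a set containing
  \<open>f\<close> alone behaves as if \<open>f\<close> were \<open>e\<close>. The condition refers
  to the old independent sets only, so that it can be matched with the rule for trees.\<close>

lemma graphic_indep_add_parallel:
  assumes g: "multigraph V E ends" and e: "e \<in> E" and f: "f \<notin> E"
  shows "F \<in> graphic_indep (insert f E) (ends(f := ends e)) \<longleftrightarrow>
    F \<subseteq> insert f E \<and> \<not> (e \<in> F \<and> f \<in> F) \<and>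
    (if f \<in> F then insert e (F - {f}) else F) \<in> graphic_indep E ends"
proof -
  let ?ends = "ends(f := ends e)"
  have ef: "e \<noteq> f" using e f by auto
  have g': "multigraph V (insert f E) ?ends" using g e by (auto simp: multigraph_def)
  note iff = graphic_indep_iff[OF g] and iff' = graphic_indep_iff[OF g']
  have same: "degree ?ends C v = degree ends C v" if "f \<notin> C" for C v
    unfolding degree_def using that by (intro arg_cong[where f = card]) auto
  have swap: "degree ?ends (insert f (C - {e})) v = degree ends C v" if "f \<notin> C" "e \<in> C" for C v
    unfolding degree_def
    by (rule bij_betw_same_card[of "\<lambda>x. if x = f then e else x"], rule bij_betw_byWitness[where f' = "\<lambda>x. if x = e then f else x"])
       (use that ef in \<open>auto split: if_splits\<close>)
  consider "f \<notin> F" | "f \<in> F" "e \<in> F" | "f \<in> F" "e \<notin> F" by blast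
  then show ?thesis
  proof cases
    case 1
    then have "degree ?ends C v = degree ends C v" if "C \<subseteq> F" for C v
      using same that by blast
    then have "(\<forall>C\<subseteq>F. C \<noteq> {} \<longrightarrow> (\<exists>v. degree ?ends C v = 1)) \<longleftrightarrow>
        (\<forall>C\<subseteq>F. C \<noteq> {} \<longrightarrow> (\<exists>v. degree ends C v = 1))" by simp
    then show ?thesis unfolding iff iff' using 1 by (simp add: subset_insert)
  next
    case 2
    \<comment> \<open>The pair has only the degrees 0 and 2, so it is a dependent subset by
      itself.\<close>
    have "degree ?ends {e, f} v \<noteq> 1" for v
    proof -
      have "{x \<in> {e, f}. v \<in> ?ends x} = (if v \<in> ends e then {e, f} else {})"
        using ef by auto
      then show ?thesis using ef by (simp add: degree_def)
    qed
    then have "F \<notin> graphic_indep (insert f E) ?ends"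
      unfolding iff' using 2 by (auto intro!: exI[of _ "{e, f}"])
    then show ?thesis using 2 by simp
  next
    case 3
    have "(\<forall>C\<subseteq>F. C \<noteq> {} \<longrightarrow> (\<exists>v. degree ?ends C v = 1)) \<longleftrightarrow>
       (\<forall>C\<subseteq>insert e (F - {f}). C \<noteq> {} \<longrightarrow> (\<exists>v. degree ends C v = 1))" (is "?L \<longleftrightarrow> ?R")
    proof
      assume L: ?L
      show ?R
      proof (intro allI impI)
        fix C assume C: "C \<subseteq> insert e (F - {f})" "C \<noteq> {}"
        then have fC: "f \<notin> C" using ef by blast
        show "\<exists>v. degree ends C v = 1"
        proof (cases "e \<in> C")
          case True
          have "insert f (C - {e}) \<subseteq> F" using C 3 by auto
          then obtain v where "degree ?ends (insert f (C - {e})) v = 1" using L by blast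
          then show ?thesis using swap[OF fC True] by auto
        next
          case False
          then have "C \<subseteq> F" using C by auto
          then show ?thesis using L C same[OF fC] by metis
        qed
      qed
    next
      assume R: ?R
      show ?L
      proof (intro allI impI)
        fix C assume C: "C \<subseteq> F" "C \<noteq> {}"
        show "\<exists>v. degree ?ends C v = 1"
        proof (cases "f \<in> C")
          case True
          let ?C = "insert e (C - {f})"
          have "?C \<subseteq> insert e (F - {f})" using C by auto
          then obtain v where "degree ends ?C v = 1" using R by blast
          moreover have "insert f (?C - {e}) = C" using True C 3 by auto
          ultimately show ?thesis using swap[of ?C] ef by auto
        next
          case False
          then have "C \<subseteq> insert e (F - {f})" using C by auto
          then show ?thesis using R C same[OF False] by metis
        qed
      qed
    qed
    then show ?thesis unfolding iff iff' using 3 e by auto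
  qed
qed

text \<open>The new vertex \<open>w\<close> has degree one in every set containing exactly one half,
  so such sets are harmless; a set containing both halves behaves like the old set containing
  \<open>e\<close>.\<close>

lemma graphic_indep_subdivide:
  assumes g: "multigraph V E ends" and e: "e \<in> E" and f: "f \<notin> E" and w: "w \<notin> V"
    and uv: "ends e = {u, v}"
  shows "F \<in> graphic_indep (insert f E) (ends(e := {u, w}, f := {w, v})) \<longleftrightarrow>
    F \<subseteq> insert f E \<and> (if f \<in> F then F - {f} else F - {e}) \<in> graphic_indep E ends"
proof -
  let ?ends = "ends(e := {u, w}, f := {w, v})"
  have ef: "e \<noteq> f" using e f by auto
  have V: "u \<in> V" "v \<in> V" "u \<noteq> v" using g e uv by (auto simp: multigraph_def)
  then have wuv: "w \<noteq> u" "w \<noteq> v" using w by auto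
  have wE: "w \<notin> ends x" if "x \<in> E" for x using g w that by (auto simp: multigraph_def)
  have g': "multigraph (insert w V) (insert f E) ?ends"
    using g e V wuv by (auto simp: multigraph_def card_insert_if)
  note iff = graphic_indep_iff[OF g] and iff' = graphic_indep_iff[OF g']
  have same: "degree ?ends C x = degree ends C x" if "f \<notin> C" "e \<notin> C" for C x
    unfolding degree_def using that by (intro arg_cong[where f = card]) auto
  have both: "degree ?ends (insert f C) x = (if x = w then 2 else degree ends C x)"
    if C: "C \<subseteq> E" "e \<in> C" for C x
  proof -
    have fC: "f \<notin> C" using C f by auto
    consider "x = w" | "x = v" | "x \<noteq> w" "x \<noteq> v" by blast
    then show ?thesis
    proof cases
      case 1
      then have "{y \<in> insert f C. x \<in> ?ends y} = {e, f}"
        using C wE by (auto split: if_splits)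
      then show ?thesis using 1 ef by (simp add: degree_def)
    next
      case 2
      \<comment> \<open>At \<open>v\<close> the half \<open>f\<close> takes over from
        \<open>e\<close>. At the other old vertices \<open>f\<close> is not incident and
        \<open>e\<close> counts as before.\<close>
      have "degree ?ends (insert f C) x = degree ends C x"
        unfolding degree_def
        by (rule bij_betw_same_card[of "\<lambda>x. if x = f then e else x"], rule bij_betw_byWitness[where f' = "\<lambda>x. if x = e then f else x"])
           (use C fC ef uv V wuv 2 in \<open>auto split: if_splits\<close>)
      then show ?thesis using 2 wuv by simp
    next
      case 3
      then have "{y \<in> insert f C. x \<in> ?ends y} = {y \<in> C. x \<in> ends y}"
        using fC uv by (auto split: if_splits)
      then show ?thesis using 3 by (simp add: degree_def)
    qed
  qed
  have wdeg: "degree ends C w \<noteq> 1" if "C \<subseteq> E" for C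
  proof -
    have none: "{y \<in> C. w \<in> ends y} = {}" using that wE by auto
    show ?thesis unfolding degree_def none by simp
  qed
  have one: "degree ?ends C w = 1" if "C \<subseteq> insert f E" "(e \<in> C) \<noteq> (f \<in> C)" for C
  proof -
    have "{y \<in> C. w \<in> ?ends y} = (if e \<in> C then {e} else {f})"
      using that wE by (auto split: if_splits)
    then show ?thesis by (simp add: degree_def)
  qed
  have "(\<forall>C\<subseteq>F. C \<noteq> {} \<longrightarrow> (\<exists>v. degree ?ends C v = 1)) \<longleftrightarrow>
     (\<forall>C\<subseteq>(if f \<in> F then F - {f} else F - {e}). C \<noteq> {} \<longrightarrow> (\<exists>v. degree ends C v = 1))" (is "?L \<longleftrightarrow> ?R")
    if F: "F \<subseteq> insert f E"
  proof
    assume L: ?L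
    show ?R
    proof (intro allI impI)
      fix C assume C: "C \<subseteq> (if f \<in> F then F - {f} else F - {e})" "C \<noteq> {}"
      then have fC: "f \<notin> C" "C \<subseteq> F" by (auto split: if_splits)
      then have CE: "C \<subseteq> E" using F by auto
      show "\<exists>v. degree ends C v = 1"
      proof (cases "e \<in> C")
        case True
        then have "insert f C \<subseteq> F" using C by (auto split: if_splits)
        then obtain x where "degree ?ends (insert f C) x = 1" using L by blast
        then show ?thesis using both[OF CE True, of x] by (auto split: if_splits)
      next
        case False
        then show ?thesis using L C fC same by metis
      qed
    qed
  next
    assume R: ?R
    show ?L
    proof (intro allI impI)
      fix C assume C: "C \<subseteq> F" "C \<noteq> {}"
      have CE: "C \<subseteq> insert f E" using C F by blast
      consider "(e \<in> C) \<noteq> (f \<in> C)" | "e \<in> C" "f \<in> C" | "e \<notin> C" "f \<notin> C" by blast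
      then show "\<exists>v. degree ?ends C v = 1"
      proof cases
        case 1
        then show ?thesis using one CE by blast
      next
        case 2
        have s: "C - {f} \<subseteq> E" "e \<in> C - {f}" "insert f (C - {f}) = C" using CE 2 ef by auto
        have "C - {f} \<subseteq> (if f \<in> F then F - {f} else F - {e})" using C 2 by auto
        then obtain x where x: "degree ends (C - {f}) x = 1" using R s by blast
        then have "x \<noteq> w" using wdeg[OF s(1)] by metis
        then show ?thesis using both[OF s(1,2), of x] s(3) x by auto
      next
        case 3
        then have "C \<subseteq> (if f \<in> F then F - {f} else F - {e})" using C by auto
        then show ?thesis using R C same[OF 3(2,1)] by metis
      qed
    qed
  qed
  moreover have "F \<subseteq> insert f E \<Longrightarrow> (if f \<in> F then F - {f} else F - {e}) \<subseteq> E" by auto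
  ultimately show ?thesis unfolding iff iff' by blast
qed

section \<open>Series-parallel trees\<close>

datatype 'a sptree =
  is_Leaf: Leaf 'a | is_Ser: Ser "'a sptree" "'a sptree" | is_Par: Par "'a sptree" "'a sptree"

fun leaves :: "'a sptree \<Rightarrow> 'a set" where
  "leaves (Leaf a) = {a}"
| "leaves (Ser l r) = leaves l \<union> leaves r"
| "leaves (Par l r) = leaves l \<union> leaves r"

fun distinct_leaves :: "'a sptree \<Rightarrow> bool" where
  "distinct_leaves (Leaf a) = True"
| "distinct_leaves (Ser l r) = (distinct_leaves l \<and> distinct_leaves r \<and> leaves l \<inter> leaves r = {})"
| "distinct_leaves (Par l r) = (distinct_leaves l \<and> distinct_leaves r \<and> leaves l \<inter> leaves r = {})"

fun conn :: "'a sptree \<Rightarrow> 'a set \<Rightarrow> bool" where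
  "conn (Leaf a) X = (a \<in> X)"
| "conn (Ser l r) X = (conn l X \<and> conn r X)"
| "conn (Par l r) X = (conn l X \<or> conn r X)"

text \<open>A cycle using both sides of a parallel node exists exactly when both sides connect the
  terminals. No edge outside the network is taken into account.\<close>

fun forest :: "'a sptree \<Rightarrow> 'a set \<Rightarrow> bool" where
  "forest (Leaf a) X = True"
| "forest (Ser l r) X = (forest l X \<and> forest r X)"
| "forest (Par l r) X = (forest l X \<and> forest r X \<and> \<not> (conn l X \<and> conn r X))"

text \<open>
  The matroid of a two-terminal network \<open>T\<close> with the terminals joined by an edge \<open>e\<close> is
  \<open>forests (Par T (Leaf e))\<close>.
\<close>

definition forests :: "'a sptree \<Rightarrow> 'a set set" where
  "forests T = {F. F \<subseteq> leaves T \<and> forest T F}"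

lemma finite_leaves [simp]: "finite (leaves T)"
  by (induction T) auto

lemma leaves_nonempty [simp]: "leaves T \<noteq> {}"
  by (induction T) auto

lemma conn_cong: "X \<inter> leaves T = Y \<inter> leaves T \<Longrightarrow> conn T X = conn T Y"
  by (induction T) (simp; blast)+

lemma forest_cong: "X \<inter> leaves T = Y \<inter> leaves T \<Longrightarrow> forest T X = forest T Y"
proof (induction T)
  case (Ser l r)
  then have "X \<inter> leaves l = Y \<inter> leaves l" "X \<inter> leaves r = Y \<inter> leaves r" by auto
  then show ?case using Ser.IH by simp
next
  case (Par l r)
  then have "X \<inter> leaves l = Y \<inter> leaves l" "X \<inter> leaves r = Y \<inter> leaves r" by auto
  then show ?case using Par.IH conn_cong[of X l Y] conn_cong[of X r Y] by simp
qed auto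

lemma conn_mono: "conn T X \<Longrightarrow> X \<subseteq> Y \<Longrightarrow> conn T Y"
  by (induction T) auto

lemma forest_antimono: "forest T X \<Longrightarrow> Y \<subseteq> X \<Longrightarrow> forest T Y"
  by (induction T) (auto dest: conn_mono)

lemma not_conn_empty [simp]: "\<not> conn T {}"
  by (induction T) auto

lemma forest_empty [simp]: "forest T {}"
  by (induction T) auto

lemma conn_leaves: "leaves T \<subseteq> X \<Longrightarrow> conn T X"
  by (induction T) auto

lemma not_conn_disjoint: "X \<inter> leaves T = {} \<Longrightarrow> \<not> conn T X"
  using conn_cong[of X T "{}"] by simp

section \<open>Grafting and removing cherries\<close>

fun graft :: "'a \<Rightarrow> 'a sptree \<Rightarrow> 'a sptree \<Rightarrow> 'a sptree" where
  "graft a N (Leaf b) = (if a = b then N else Leaf b)"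
| "graft a N (Ser l r) = Ser (graft a N l) (graft a N r)"
| "graft a N (Par l r) = Par (graft a N l) (graft a N r)"

lemma graft_id: "a \<notin> leaves T \<Longrightarrow> graft a N T = T"
  by (induction T) auto

lemma leaves_graft: "a \<in> leaves T \<Longrightarrow> leaves (graft a N T) = (leaves T - {a}) \<union> leaves N"
proof (induction T)
  case (Ser l r)
  then show ?case by (cases "a \<in> leaves l"; cases "a \<in> leaves r") (auto simp: graft_id)
next
  case (Par l r)
  then show ?case by (cases "a \<in> leaves l"; cases "a \<in> leaves r") (auto simp: graft_id)
qed auto

lemma distinct_leaves_graft:
  "distinct_leaves T \<Longrightarrow> distinct_leaves N \<Longrightarrow> leaves N \<inter> leaves T \<subseteq> {a} \<Longrightarrow> distinct_leaves (graft a N T)"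
proof (induction T)
  case (Ser l r)
  then show ?case
    by (cases "a \<in> leaves l"; cases "a \<in> leaves r") (auto simp: graft_id leaves_graft)
next
  case (Par l r)
  then show ?case
    by (cases "a \<in> leaves l"; cases "a \<in> leaves r") (auto simp: graft_id leaves_graft)
qed auto

lemma conn_insert_notin [simp]: "b \<notin> leaves T \<Longrightarrow> conn T (insert b X) = conn T X"
  by (rule conn_cong) auto

lemma conn_diff_notin [simp]: "b \<notin> leaves T \<Longrightarrow> conn T (X - {b}) = conn T X"
  by (rule conn_cong) auto

lemma forest_insert_notin [simp]: "b \<notin> leaves T \<Longrightarrow> forest T (insert b X) = forest T X"
  by (rule forest_cong) auto

lemma forest_diff_notin [simp]: "b \<notin> leaves T \<Longrightarrow> forest T (X - {b}) = forest T X"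
  by (rule forest_cong) auto

lemma conn_graft_Par:
  assumes "f \<notin> leaves T"
  shows "conn (graft a (Par (Leaf a) (Leaf f)) T) X = conn T (if f \<in> X then insert a X else X)"
  using assms by (induction T) auto

lemma forest_graft_Par:
  assumes "f \<notin> leaves T" "distinct_leaves T" "a \<in> leaves T"
  shows "forest (graft a (Par (Leaf a) (Leaf f)) T) X \<longleftrightarrow>
    \<not> (a \<in> X \<and> f \<in> X) \<and> forest T (if f \<in> X then insert a X else X)"
  using assms
proof (induction T)
  case (Ser l r)
  then consider "a \<in> leaves l" "a \<notin> leaves r" | "a \<notin> leaves l" "a \<in> leaves r" by auto
  then show ?case using Ser by cases (auto simp: graft_id)
next
  case (Par l r)
  then consider "a \<in> leaves l" "a \<notin> leaves r" | "a \<notin> leaves l" "a \<in> leaves r" by auto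
  then show ?case using Par by cases (auto simp: graft_id conn_graft_Par)
qed auto

lemma conn_graft_Ser:
  assumes "f \<notin> leaves T"
  shows "conn (graft a (Ser (Leaf a) (Leaf f)) T) X = conn T (if f \<in> X then X else X - {a})"
  using assms by (induction T) auto

lemma forest_graft_Ser:
  assumes "f \<notin> leaves T"
  shows "forest (graft a (Ser (Leaf a) (Leaf f)) T) X = forest T (if f \<in> X then X else X - {a})"
  using assms by (induction T) (auto simp: conn_graft_Ser)

text \<open>Grafting a pair of leaves is the tree version of extending one edge. The right-hand
  sides of this rule and of \<open>forests_graft_Ser\<close> copy those found for graphs in
  \<open>graphic_indep_add_parallel\<close> and \<open>graphic_indep_subdivide\<close>.\<close>

lemma forests_graft_Par:
  assumes "f \<notin> leaves T" "distinct_leaves T" "a \<in> leaves T"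
  shows "F \<in> forests (graft a (Par (Leaf a) (Leaf f)) T) \<longleftrightarrow>
    F \<subseteq> insert f (leaves T) \<and> \<not> (a \<in> F \<and> f \<in> F) \<and>
    (if f \<in> F then insert a (F - {f}) else F) \<in> forests T"
proof -
  have "insert a (F - {f}) = insert a F - {f}" using assms by auto
  moreover have "leaves (graft a (Par (Leaf a) (Leaf f)) T) = insert f (leaves T)"
    using assms leaves_graft[OF assms(3)] by auto
  ultimately show ?thesis
    using assms unfolding forests_def by (auto simp: forest_graft_Par)
qed

lemma forests_graft_Ser:
  assumes "f \<notin> leaves T" "a \<in> leaves T"
  shows "F \<in> forests (graft a (Ser (Leaf a) (Leaf f)) T) \<longleftrightarrow>
    F \<subseteq> insert f (leaves T) \<and> (if f \<in> F then F - {f} else F - {a}) \<in> forests T"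
proof -
  have "leaves (graft a (Ser (Leaf a) (Leaf f)) T) = insert f (leaves T)"
    using assms leaves_graft[OF assms(2)] by auto
  then show ?thesis
    using assms unfolding forests_def by (auto simp: forest_graft_Ser)
qed

lemma distinct_leaves_graft_cherry:
  assumes "N = Ser (Leaf a) (Leaf f) \<or> N = Par (Leaf a) (Leaf f)"
    and "distinct_leaves T" "a \<in> leaves T" "f \<notin> leaves T"
  shows "distinct_leaves (graft a N T)" "leaves (graft a N T) = insert f (leaves T)"
proof -
  have N: "leaves N = {a, f}" "distinct_leaves N" using assms by auto
  show "leaves (graft a N T) = insert f (leaves T)"
    unfolding leaves_graft[OF assms(3)] N using assms(3) by blast
  show "distinct_leaves (graft a N T)"
    using assms(2,4) N by (intro distinct_leaves_graft) auto
qed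

definition cherry :: "'a \<Rightarrow> 'a \<Rightarrow> 'a sptree \<Rightarrow> bool" where
  "cherry a f N \<longleftrightarrow> N = Ser (Leaf a) (Leaf f) \<or> N = Par (Leaf a) (Leaf f)"

text \<open>Undoes one extension step: \<open>U\<close> arises from \<open>T\<close> by contracting
  a node with two leaf children to the leaf \<open>a\<close>. Every tree that is not a leaf has such
  a node.\<close>

definition cherry_reduct :: "'a sptree \<Rightarrow> 'a \<Rightarrow> 'a \<Rightarrow> 'a sptree \<Rightarrow> 'a sptree \<Rightarrow> bool" where
  "cherry_reduct T a f N U \<longleftrightarrow> cherry a f N \<and> T = graft a N U \<and> distinct_leaves U \<and>
    a \<in> leaves U \<and> f \<notin> leaves U"

lemma leaves_cherry_reduct: "cherry_reduct T a f N U \<Longrightarrow> leaves T = insert f (leaves U)"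
  unfolding cherry_reduct_def cherry_def by (elim conjE) (simp add: distinct_leaves_graft_cherry(2))

lemma cherry_reduct_cong:
  assumes "cherry_reduct T a f N U" "leaves T \<inter> leaves T' = {}" "distinct_leaves T'"
  shows "cherry_reduct (Ser T T') a f N (Ser U T')" "cherry_reduct (Ser T' T) a f N (Ser T' U)"
    "cherry_reduct (Par T T') a f N (Par U T')" "cherry_reduct (Par T' T) a f N (Par T' U)"
proof -
  have "a \<in> leaves T" "f \<in> leaves T" "leaves U \<subseteq> leaves T"
    using leaves_cherry_reduct[OF assms(1)] assms(1) by (auto simp: cherry_reduct_def)
  then have *: "a \<notin> leaves T'" "f \<notin> leaves T'" "leaves U \<inter> leaves T' = {}" "leaves T' \<inter> leaves U = {}"
    using assms(2) by auto
  show "cherry_reduct (Ser T T') a f N (Ser U T')" "cherry_reduct (Ser T' T) a f N (Ser T' U)"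
    "cherry_reduct (Par T T') a f N (Par U T')" "cherry_reduct (Par T' T) a f N (Par T' U)"
    using assms(1,3) * by (simp_all add: cherry_reduct_def graft_id)
qed

lemma cherry_reduct_cherry:
  "cherry a f N \<Longrightarrow> a \<noteq> f \<Longrightarrow> cherry_reduct N a f N (Leaf a)"
  by (auto simp: cherry_reduct_def)

lemma ex_cherry_reduct:
  assumes "distinct_leaves T" "\<not> is_Leaf T"
  shows "\<exists>a f N U. cherry_reduct T a f N U"
  using assms
proof (induction T)
  case (Ser l r)
  show ?case
  proof (cases "is_Leaf l \<and> is_Leaf r")
    case True
    then obtain a f where "l = Leaf a" "r = Leaf f" by (auto simp: is_Leaf_def)
    then show ?thesis using cherry_reduct_cherry[of a f "Ser l r"] Ser.prems
      by (auto simp: cherry_def)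
  next
    case False
    then show ?thesis using Ser cherry_reduct_cong(1)[of l _ _ _ _ r] cherry_reduct_cong(2)[of r _ _ _ _ l]
      by (metis distinct_leaves.simps(2) inf_commute)
  qed
next
  case (Par l r)
  show ?case
  proof (cases "is_Leaf l \<and> is_Leaf r")
    case True
    then obtain a f where "l = Leaf a" "r = Leaf f" by (auto simp: is_Leaf_def)
    then show ?thesis using cherry_reduct_cherry[of a f "Par l r"] Par.prems
      by (auto simp: cherry_def)
  next
    case False
    then show ?thesis using Par cherry_reduct_cong(3)[of l _ _ _ _ r] cherry_reduct_cong(4)[of r _ _ _ _ l]
      by (metis distinct_leaves.simps(3) inf_commute)
  qed
qed auto

text \<open>The cherry is taken inside a child, so the root remains parallel and the reduction ends
  at two parallel leaves, the starting graph of \<open>sp_graph\<close>.\<close>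

lemma ex_cherry_reduct_Par:
  assumes d: "distinct_leaves (Par l r)" and nl: "\<not> (is_Leaf l \<and> is_Leaf r)"
  shows "\<exists>a f N l' r'. cherry_reduct (Par l r) a f N (Par l' r')"
  using d nl ex_cherry_reduct[of l] ex_cherry_reduct[of r]
    cherry_reduct_cong(3)[of l _ _ _ _ r] cherry_reduct_cong(4)[of r _ _ _ _ l]
  by (metis distinct_leaves.simps(3) inf_commute)

lemma forests_parallel_pair:
  assumes "u \<noteq> v" "e \<noteq> f" "ends e = {u, v}" "ends f = {u, v}"
  shows "forests (Par (Leaf e) (Leaf f)) = graphic_indep {e, f} ends"
proof (rule set_eqI)
  fix F
  have g: "multigraph {u, v} {e, f} ends"
    using assms by (auto simp: multigraph_def)
  have deg: "degree ends C x = (if x \<in> {u, v} then card C else 0)" if "C \<subseteq> {e, f}" for C x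
  proof -
    have "{y \<in> C. x \<in> ends y} = (if x \<in> {u, v} then C else {})"
      using that assms by auto
    then show ?thesis by (simp add: degree_def)
  qed
  have "(\<exists>x. degree ends C x = 1) \<longleftrightarrow> card C = 1" if "C \<subseteq> {e, f}" for C
    using deg[OF that] by auto
  then have "F \<in> graphic_indep {e, f} ends \<longleftrightarrow> F \<subseteq> {e, f} \<and> (\<forall>C\<subseteq>F. C \<noteq> {} \<longrightarrow> card C = 1)"
    unfolding graphic_indep_iff[OF g] by (meson order_trans)
  also have "\<dots> \<longleftrightarrow> F \<subseteq> {e, f} \<and> F \<noteq> {e, f}"
  proof (intro conj_cong refl)
    assume F: "F \<subseteq> {e, f}"
    show "(\<forall>C\<subseteq>F. C \<noteq> {} \<longrightarrow> card C = 1) \<longleftrightarrow> F \<noteq> {e, f}"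
    proof
      assume *: "\<forall>C\<subseteq>F. C \<noteq> {} \<longrightarrow> card C = 1"
      show "F \<noteq> {e, f}"
      proof
        assume "F = {e, f}"
        then have "card F = 1" using * by blast
        then show False using \<open>F = {e, f}\<close> assms(2) by simp
      qed
    next
      assume "F \<noteq> {e, f}"
      then have "F = {} \<or> F = {e} \<or> F = {f}" using F by blast
      then show "\<forall>C\<subseteq>F. C \<noteq> {} \<longrightarrow> card C = 1" by (auto simp: subset_singleton_iff)
    qed
  qed
  also have "\<dots> \<longleftrightarrow> F \<in> forests (Par (Leaf e) (Leaf f))" by (auto simp: forests_def)
  finally show "F \<in> forests (Par (Leaf e) (Leaf f)) \<longleftrightarrow> F \<in> graphic_indep {e, f} ends" by blast
qed

text \<open>Grafting acts at the leaves only, so the parallel node of the initial pair stays at the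
  root throughout.\<close>

lemma sp_graph_imp_forests:
  assumes "sp_graph V E ends"
  shows "\<exists>l r. distinct_leaves (Par l r) \<and> leaves (Par l r) = E \<and> forests (Par l r) = graphic_indep E ends"
  using assms
proof (induction rule: sp_graph.induct)
  case (parallel_pair u v e f ends)
  have "distinct_leaves (Par (Leaf e) (Leaf f))" "leaves (Par (Leaf e) (Leaf f)) = {e, f}"
    using parallel_pair(2) by auto
  then show ?case using forests_parallel_pair[OF parallel_pair] by blast
next
  case (add_parallel V E ends e f)
  then obtain l r where T: "distinct_leaves (Par l r)" "leaves (Par l r) = E"
    "forests (Par l r) = graphic_indep E ends" by blast
  let ?N = "Par (Leaf e) (Leaf f)"
  have ef: "e \<in> leaves (Par l r)" "f \<notin> leaves (Par l r)" unfolding T(2) using add_parallel by auto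
  have "forests (graft e ?N (Par l r)) = graphic_indep (insert f E) (ends(f := ends e))"
    using forests_graft_Par[OF ef(2) T(1) ef(1)] T
      graphic_indep_add_parallel[OF sp_graph_multigraph[OF add_parallel(1)] add_parallel(2,3)]
    by (intro set_eqI) metis
  moreover have "distinct_leaves (graft e ?N (Par l r))" "leaves (graft e ?N (Par l r)) = insert f E"
    using distinct_leaves_graft_cherry[of ?N e f "Par l r"] ef T by auto
  ultimately show ?case by (metis graft.simps(3))
next
  case (subdivide V E ends e u v f w)
  then obtain l r where T: "distinct_leaves (Par l r)" "leaves (Par l r) = E"
    "forests (Par l r) = graphic_indep E ends" by blast
  let ?N = "Ser (Leaf e) (Leaf f)"
  have ef: "e \<in> leaves (Par l r)" "f \<notin> leaves (Par l r)" unfolding T(2) using subdivide by auto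
  have "forests (graft e ?N (Par l r)) = graphic_indep (insert f E) (ends(e := {u, w}, f := {w, v}))"
    using forests_graft_Ser[OF ef(2,1)] T
      graphic_indep_subdivide[OF sp_graph_multigraph[OF subdivide(1)] subdivide(2,4,5,3)]
    by (intro set_eqI) metis
  moreover have "distinct_leaves (graft e ?N (Par l r))" "leaves (graft e ?N (Par l r)) = insert f E"
    using distinct_leaves_graft_cherry[of ?N e f "Par l r"] ef T by auto
  ultimately show ?case by (metis graft.simps(3))
qed

text \<open>Induction on the number of leaves: contract a cherry, take a graph for the smaller tree,
  and extend the edge \<open>a\<close> accordingly.\<close>

lemma forests_imp_sp_graph:
  assumes "distinct_leaves (Par l r)"
  shows "\<exists>(V :: nat set) ends. sp_graph V (leaves (Par l r)) ends \<and>
    forests (Par l r) = graphic_indep (leaves (Par l r)) ends"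
  using assms
proof (induction "card (leaves (Par l r))" arbitrary: l r rule: less_induct)
  case less
  show ?case
  proof (cases "is_Leaf l \<and> is_Leaf r")
    case True
    then obtain e f where ef: "l = Leaf e" "r = Leaf f" by (auto simp: is_Leaf_def)
    then have "e \<noteq> f" using less by auto
    then have "sp_graph {0::nat, 1} {e, f} (\<lambda>_. {0, 1})" by (intro parallel_pair) auto
    moreover have "forests (Par l r) = graphic_indep {e, f} (\<lambda>_. {0::nat, 1})"
      unfolding ef using \<open>e \<noteq> f\<close> by (intro forests_parallel_pair) auto
    moreover have "leaves (Par l r) = {e, f}" using ef by auto
    ultimately show ?thesis by metis
  next
    case False
    then obtain l' r' a f N where red: "cherry_reduct (Par l r) a f N (Par l' r')"
      using ex_cherry_reduct_Par[OF less(2)] by blast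
    note red' = red[unfolded cherry_reduct_def cherry_def]
    have N: "N = Ser (Leaf a) (Leaf f) \<or> N = Par (Leaf a) (Leaf f)"
      by (rule red'[THEN conjunct1])
    have U: "Par l r = graft a N (Par l' r')" "distinct_leaves (Par l' r')"
      "a \<in> leaves (Par l' r')" "f \<notin> leaves (Par l' r')"
      by (rule red'[THEN conjunct2, THEN conjunct1] red'[THEN conjunct2, THEN conjunct2, THEN conjunct1]
          red'[THEN conjunct2, THEN conjunct2, THEN conjunct2, THEN conjunct1]
          red'[THEN conjunct2, THEN conjunct2, THEN conjunct2, THEN conjunct2])+
    note lv = leaves_cherry_reduct[OF red]
    have "card (leaves (Par l' r')) < card (leaves (Par l r))" unfolding lv using U(4) by simp
    from less(1)[OF this U(2)] obtain V :: "nat set" and ends where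
      G: "sp_graph V (leaves (Par l' r')) ends"
        "forests (Par l' r') = graphic_indep (leaves (Par l' r')) ends" by blast
    have mg: "multigraph V (leaves (Par l' r')) ends" by (rule sp_graph_multigraph[OF G(1)])
    from N show ?thesis
    proof
      assume N: "N = Ser (Leaf a) (Leaf f)"
      obtain w where w: "w \<notin> V" using mg ex_new_if_finite[of V] by (auto simp: multigraph_def)
      obtain u v where uv: "ends a = {u, v}" using mg U(3) unfolding multigraph_def card_2_iff by metis
      have "sp_graph (insert w V) (insert f (leaves (Par l' r'))) (ends(a := {u, w}, f := {w, v}))"
        using sp_graph.subdivide[OF G(1) U(3) uv U(4) w] .
      moreover have "forests (Par l r) = graphic_indep (leaves (Par l r)) (ends(a := {u, w}, f := {w, v}))"
        unfolding lv unfolding U(1) N using forests_graft_Ser[OF U(4,3)] G(2) graphic_indep_subdivide[OF mg U(3,4) w uv]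
        by (intro set_eqI) metis
      ultimately show ?thesis unfolding lv by blast
    next
      assume N: "N = Par (Leaf a) (Leaf f)"
      have "sp_graph V (insert f (leaves (Par l' r'))) (ends(f := ends a))"
        using sp_graph.add_parallel[OF G(1) U(3) U(4)] .
      moreover have "forests (Par l r) = graphic_indep (leaves (Par l r)) (ends(f := ends a))"
        unfolding lv unfolding U(1) N using forests_graft_Par[OF U(4,2,3)] G(2) graphic_indep_add_parallel[OF mg U(3,4)]
        by (intro set_eqI) metis
      ultimately show ?thesis unfolding lv by blast
    qed
  qed
qed

text \<open>\<open>Par l (Ser r1 r2)\<close> and \<open>Par (Ser l r1) r2\<close> are the same
  cyclic arrangement of three networks, and parallel nodes may be reassociated; each such move
  brings \<open>e\<close> one level closer to the root. Only \<open>forest\<close> is preserved: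
  \<open>conn\<close> changes because the terminals move.\<close>

lemma reroot_aux:
  assumes "distinct_leaves (Par l r)" "e \<in> leaves r"
  shows "\<exists>T. distinct_leaves T \<and> leaves T = leaves (Par l r) - {e} \<and>
    (\<forall>F. forest (Par T (Leaf e)) F = forest (Par l r) F)"
  using assms
proof (induction r arbitrary: l)
  case (Leaf x)
  then show ?case by (intro exI[of _ l]) auto
next
  case (Ser r1 r2)
  show ?case
  proof (cases "e \<in> leaves r2")
    case True
    from Ser.IH(2)[of "Ser l r1"] True Ser.prems obtain T where T: "distinct_leaves T"
      "leaves T = leaves (Par (Ser l r1) r2) - {e}"
      "\<And>F. forest (Par T (Leaf e)) F = forest (Par (Ser l r1) r2) F" by auto
    have "forest (Par (Ser l r1) r2) F = forest (Par l (Ser r1 r2)) F" for F by auto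
    moreover have "leaves (Par (Ser l r1) r2) = leaves (Par l (Ser r1 r2))" by auto
    ultimately show ?thesis using T by metis
  next
    case False
    from Ser.IH(1)[of "Ser l r2"] False Ser.prems obtain T where T: "distinct_leaves T"
      "leaves T = leaves (Par (Ser l r2) r1) - {e}"
      "\<And>F. forest (Par T (Leaf e)) F = forest (Par (Ser l r2) r1) F" by auto
    have "forest (Par (Ser l r2) r1) F = forest (Par l (Ser r1 r2)) F" for F by auto
    moreover have "leaves (Par (Ser l r2) r1) = leaves (Par l (Ser r1 r2))" by auto
    ultimately show ?thesis using T by metis
  qed
next
  case (Par r1 r2)
  show ?case
  proof (cases "e \<in> leaves r2")
    case True
    from Par.IH(2)[of "Par l r1"] True Par.prems obtain T where T: "distinct_leaves T"
      "leaves T = leaves (Par (Par l r1) r2) - {e}"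
      "\<And>F. forest (Par T (Leaf e)) F = forest (Par (Par l r1) r2) F" by auto
    have "forest (Par (Par l r1) r2) F = forest (Par l (Par r1 r2)) F" for F by auto
    moreover have "leaves (Par (Par l r1) r2) = leaves (Par l (Par r1 r2))" by auto
    ultimately show ?thesis using T by metis
  next
    case False
    from Par.IH(1)[of "Par l r2"] False Par.prems obtain T where T: "distinct_leaves T"
      "leaves T = leaves (Par (Par l r2) r1) - {e}"
      "\<And>F. forest (Par T (Leaf e)) F = forest (Par (Par l r2) r1) F" by auto
    have "forest (Par (Par l r2) r1) F = forest (Par l (Par r1 r2)) F" for F by auto
    moreover have "leaves (Par (Par l r2) r1) = leaves (Par l (Par r1 r2))" by auto
    ultimately show ?thesis using T by metis
  qed
qed

lemma reroot:
  assumes "distinct_leaves (Par l r)" "e \<in> leaves (Par l r)"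
  shows "\<exists>T. distinct_leaves (Par T (Leaf e)) \<and> leaves T = leaves (Par l r) - {e} \<and>
    forests (Par T (Leaf e)) = forests (Par l r)"
proof -
  have "\<exists>T. distinct_leaves T \<and> leaves T = leaves (Par l r) - {e} \<and>
    (\<forall>F. forest (Par T (Leaf e)) F = forest (Par l r) F)"
  proof (cases "e \<in> leaves r")
    case True
    then show ?thesis using reroot_aux[of l r e] assms by blast
  next
    case False
    then obtain T where T: "distinct_leaves T" "leaves T = leaves (Par r l) - {e}"
      "\<And>F. forest (Par T (Leaf e)) F = forest (Par r l) F"
      using reroot_aux[of r l e] assms by auto
    have "forest (Par r l) F = forest (Par l r) F" for F by auto
    moreover have "leaves (Par r l) = leaves (Par l r)" by auto
    ultimately show ?thesis using T by metis
  qed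
  then obtain T where T: "distinct_leaves T" "leaves T = leaves (Par l r) - {e}"
    "\<And>F. forest (Par T (Leaf e)) F = forest (Par l r) F" by blast
  have lv: "leaves (Par T (Leaf e)) = leaves (Par l r)" using T(2) assms(2) by auto
  have "forests (Par T (Leaf e)) = forests (Par l r)" unfolding forests_def lv T(3) ..
  moreover have "distinct_leaves (Par T (Leaf e))" using T by simp
  ultimately show ?thesis using T(2) by blast
qed

text \<open>The bound on \<open>card E\<close> removes the single-edge graph; for all others the
  tree is rerooted at the chosen \<open>e\<close>.\<close>

lemma series_parallel_matroid_iff:
  assumes "card E > 1" "e \<in> E"
  shows "series_parallel_matroid E \<I> \<longleftrightarrow>
    (\<exists>T. distinct_leaves T \<and> leaves T = E - {e} \<and> \<I> = forests (Par T (Leaf e)))"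
proof
  assume "series_parallel_matroid E \<I>"
  then obtain V :: "nat set" and ends where g: "sp_graph V E ends" "\<I> = graphic_indep E ends"
    using assms(1) by (auto simp: series_parallel_matroid_def single_edge_graph_def)
  obtain l r where lr: "distinct_leaves (Par l r)" "leaves (Par l r) = E" "forests (Par l r) = \<I>"
    using sp_graph_imp_forests[OF g(1)] g(2) by blast
  then show "\<exists>T. distinct_leaves T \<and> leaves T = E - {e} \<and> \<I> = forests (Par T (Leaf e))"
    using reroot[OF lr(1), of e] assms(2) by (metis distinct_leaves.simps(3))
next
  assume "\<exists>T. distinct_leaves T \<and> leaves T = E - {e} \<and> \<I> = forests (Par T (Leaf e))"
  then obtain T where T: "distinct_leaves T" "leaves T = E - {e}" "\<I> = forests (Par T (Leaf e))" by blast
  then have "distinct_leaves (Par T (Leaf e))" "leaves (Par T (Leaf e)) = E" using assms by auto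
  then show "series_parallel_matroid E \<I>"
    using forests_imp_sp_graph[of T "Leaf e"] T(3) unfolding series_parallel_matroid_def by auto
qed

section \<open>Rank and simplicity\<close>

text \<open>The rank function of the network's matroid: if both sides of a parallel node connect,
  their spanning forests close exactly one cycle. By \<open>rank_in_pos\<close> the truncated
  subtraction is then a true one.\<close>

fun rank_in :: "'a sptree \<Rightarrow> 'a set \<Rightarrow> nat" where
  "rank_in (Leaf a) X = (if a \<in> X then 1 else 0)"
| "rank_in (Ser l r) X = rank_in l X + rank_in r X"
| "rank_in (Par l r) X = rank_in l X + rank_in r X - (if conn l X \<and> conn r X then 1 else 0)"

lemma rank_in_pos: "conn T X \<Longrightarrow> rank_in T X > 0"
  by (induction T) auto

lemma card_leaves_Int:
  assumes "leaves l \<inter> leaves r = {}"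
  shows "card (F \<inter> (leaves l \<union> leaves r)) = card (F \<inter> leaves l) + card (F \<inter> leaves r)"
proof -
  have "F \<inter> leaves l \<inter> (F \<inter> leaves r) = {}" using assms by blast
  then show ?thesis unfolding Int_Un_distrib by (intro card_Un_disjoint) simp_all
qed

text \<open>The extra summand carries the induction: in a forest of a parallel node at least one
  side is disconnected, and it must be one short whenever \<open>X\<close> would connect it.\<close>

lemma card_forest_le:
  assumes "distinct_leaves T" "forest T F" "F \<subseteq> X"
  shows "card (F \<inter> leaves T) + (if conn T X \<and> \<not> conn T F then 1 else 0) \<le> rank_in T X"
  using assms
proof (induction T)
  case (Ser l r)
  then show ?case
    by (auto simp: card_leaves_Int split: if_splits)
next
  case (Par l r)
  have mono: "conn l F \<Longrightarrow> conn l X" "conn r F \<Longrightarrow> conn r X" using Par.prems conn_mono by blast+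
  have "rank_in l X > 0" if "conn l X" using rank_in_pos that by blast
  then show ?case using Par mono
    by (auto simp: card_leaves_Int split: if_splits)
qed auto

text \<open>Two kinds of maximality have to be treated together: among all forests inside
  \<open>X\<close>, and among those that keep the terminals apart. If one side of a parallel node
  connects, the other side is maximal only in the second sense, and at series nodes the two kinds
  mix as well.\<close>

lemma card_maximal_forest:
  assumes "distinct_leaves T" "forest T F" "F \<subseteq> X"
  shows "(\<forall>y\<in>X \<inter> leaves T - F. \<not> forest T (insert y F)) \<Longrightarrow>
      card (F \<inter> leaves T) = rank_in T X \<and> conn T F = conn T X"
    and "(\<forall>y\<in>X \<inter> leaves T - F. \<not> (forest T (insert y F) \<and> \<not> conn T (insert y F))) \<Longrightarrow> \<not> conn T F \<Longrightarrow>
      card (F \<inter> leaves T) + (if conn T X then 1 else 0) = rank_in T X"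
proof -
  have "((\<forall>y\<in>X \<inter> leaves T - F. \<not> forest T (insert y F)) \<longrightarrow>
      card (F \<inter> leaves T) = rank_in T X \<and> conn T F = conn T X) \<and>
    ((\<forall>y\<in>X \<inter> leaves T - F. \<not> (forest T (insert y F) \<and> \<not> conn T (insert y F))) \<longrightarrow> \<not> conn T F \<longrightarrow>
      card (F \<inter> leaves T) + (if conn T X then 1 else 0) = rank_in T X)"
    (is "(?M T \<longrightarrow> ?A T) \<and> (?N T \<longrightarrow> \<not> conn T F \<longrightarrow> ?B T)")
    using assms
  proof (induction T)
    case (Leaf a)
    then show ?case by auto
  next
    case (Ser l r)
    then have d: "leaves l \<inter> leaves r = {}" and fo: "forest l F" "forest r F" by auto
    then have nl: "y \<notin> leaves r" if "y \<in> leaves l" for y using that by blast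
    have nr: "y \<notin> leaves l" if "y \<in> leaves r" for y using that d by blast
    have IH: "?M l \<Longrightarrow> ?A l" "?N l \<Longrightarrow> \<not> conn l F \<Longrightarrow> ?B l" "?M r \<Longrightarrow> ?A r" "?N r \<Longrightarrow> \<not> conn r F \<Longrightarrow> ?B r"
      using Ser by auto
    show ?case
    proof (intro conjI impI)
      assume "?M (Ser l r)"
      then have "?M l" "?M r" using nl nr fo by auto
      then have "?A l" "?A r" using IH by blast+
      then show "card (F \<inter> leaves (Ser l r)) = rank_in (Ser l r) X" "conn (Ser l r) F = conn (Ser l r) X"
        using d by (auto simp: card_leaves_Int)
    next
      assume N: "?N (Ser l r)" and nc: "\<not> conn (Ser l r) F"
      have Nl: "conn l (insert y F) \<and> conn r F" if "y \<in> X \<inter> leaves l - F" "forest l (insert y F)" for y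
        using N[THEN bspec, of y] nl[of y] that fo by simp
      have Nr: "conn l F \<and> conn r (insert y F)" if "y \<in> X \<inter> leaves r - F" "forest r (insert y F)" for y
        using N[THEN bspec, of y] nr[of y] that fo by simp
      \<comment> \<open>Which sides connect decides which kind of maximality each child inherits: a
        connecting sibling passes the restriction on, a disconnected one lifts it.\<close>
      consider "conn l F" "\<not> conn r F" | "\<not> conn l F" "conn r F" | "\<not> conn l F" "\<not> conn r F" using nc by auto
      then show "?B (Ser l r)"
      proof cases
        case 1
        then have "?M l" "?N r" using Nl Nr by blast+
        then have "?A l" "?B r" using IH 1 by blast+
        then show ?thesis using 1 d by (auto simp: card_leaves_Int)
      next
        case 2
        then have "?N l" "?M r" using Nl Nr by blast+
        then have "?B l" "?A r" using IH 2 by blast+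
        then show ?thesis using 2 d by (auto simp: card_leaves_Int)
      next
        case 3
        then have "?M l" "?M r" using Nl Nr by blast+
        then have "?A l" "?A r" using IH by blast+
        then show ?thesis using 3 d by (auto simp: card_leaves_Int)
      qed
    qed
  next
    case (Par l r)
    then have d: "leaves l \<inter> leaves r = {}" and fo: "forest l F" "forest r F" "\<not> (conn l F \<and> conn r F)" by auto
    then have nl: "y \<notin> leaves r" if "y \<in> leaves l" for y using that by blast
    have nr: "y \<notin> leaves l" if "y \<in> leaves r" for y using that d by blast
    have IH: "?M l \<Longrightarrow> ?A l" "?N l \<Longrightarrow> \<not> conn l F \<Longrightarrow> ?B l" "?M r \<Longrightarrow> ?A r" "?N r \<Longrightarrow> \<not> conn r F \<Longrightarrow> ?B r"
      using Par by auto
    show ?case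
    proof (intro conjI impI)
      assume M: "?M (Par l r)"
      have Ml: "conn l (insert y F) \<and> conn r F" if "y \<in> X \<inter> leaves l - F" "forest l (insert y F)" for y
        using M[THEN bspec, of y] nl[of y] that fo by simp
      have Mr: "conn l F \<and> conn r (insert y F)" if "y \<in> X \<inter> leaves r - F" "forest r (insert y F)" for y
        using M[THEN bspec, of y] nr[of y] that fo by simp
      consider "conn l F" "\<not> conn r F" | "\<not> conn l F" "conn r F" | "\<not> conn l F" "\<not> conn r F" using fo by auto
      then have "?A (Par l r)"
      proof cases
        case 1
        then have "?M l" "?N r" using Ml Mr by blast+
        then have "?A l" "?B r" using IH 1 by blast+
        then show ?thesis using 1 d by (auto simp: card_leaves_Int)
      next
        case 2
        then have "?N l" "?M r" using Ml Mr by blast+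
        then have "?B l" "?A r" using IH 2 by blast+
        then show ?thesis using 2 d by (auto simp: card_leaves_Int)
      next
        case 3
        then have "?M l" "?M r" using Ml Mr by blast+
        then have "?A l" "?A r" using IH by blast+
        then show ?thesis using 3 d by (auto simp: card_leaves_Int)
      qed
      then show "card (F \<inter> leaves (Par l r)) = rank_in (Par l r) X" "conn (Par l r) F = conn (Par l r) X"
        by blast+
    next
      assume N: "?N (Par l r)" and nc: "\<not> conn (Par l r) F"
      then have nc': "\<not> conn l F" "\<not> conn r F" by auto
      have "conn l (insert y F)" if "y \<in> X \<inter> leaves l - F" "forest l (insert y F)" for y
        using N[THEN bspec, of y] nl[of y] that fo nc' by simp
      then have "?N l" by blast
      moreover have "conn r (insert y F)" if "y \<in> X \<inter> leaves r - F" "forest r (insert y F)" for y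
        using N[THEN bspec, of y] nr[of y] that fo nc' by simp
      then have "?N r" by blast
      ultimately have "?B l" "?B r" using IH nc' by blast+
      then show "?B (Par l r)" using d rank_in_pos[of l X] by (auto simp: card_leaves_Int)
    qed
  qed
  then show "(\<forall>y\<in>X \<inter> leaves T - F. \<not> forest T (insert y F)) \<Longrightarrow>
      card (F \<inter> leaves T) = rank_in T X \<and> conn T F = conn T X"
    and "(\<forall>y\<in>X \<inter> leaves T - F. \<not> (forest T (insert y F) \<and> \<not> conn T (insert y F))) \<Longrightarrow> \<not> conn T F \<Longrightarrow>
      card (F \<inter> leaves T) + (if conn T X then 1 else 0) = rank_in T X"
    by blast+
qed

text \<open>If no element of \<open>Y\<close> extends \<open>X\<close>, then \<open>X\<close> is a
  maximal forest inside the union of both, so its size is the rank of the union and \<open>Y\<close>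
  cannot be larger.\<close>

lemma matroid_forests:
  assumes "distinct_leaves T"
  shows "matroid (leaves T) (forests T)"
proof
  show "finite (leaves T)" "{} \<in> forests T" by (auto simp: forests_def)
  show "X \<in> forests T \<Longrightarrow> X \<subseteq> leaves T" for X by (auto simp: forests_def)
  show "X \<in> forests T \<Longrightarrow> Y \<subseteq> X \<Longrightarrow> Y \<in> forests T" for X Y
    using forest_antimono by (auto simp: forests_def)
  fix X Y assume XY: "X \<in> forests T" "Y \<in> forests T" "card X < card Y"
  show "\<exists>y\<in>Y - X. insert y X \<in> forests T"
  proof (rule ccontr)
    assume no: "\<not> ?thesis"
    have "\<not> forest T (insert y X)" if "y \<in> (X \<union> Y) \<inter> leaves T - X" for y
      using no that XY by (auto simp: forests_def)
    then have "card (X \<inter> leaves T) = rank_in T (X \<union> Y)"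
      using card_maximal_forest(1)[OF assms, of X "X \<union> Y"] XY by (auto simp: forests_def)
    moreover have "card (Y \<inter> leaves T) \<le> rank_in T (X \<union> Y)"
      using card_forest_le[OF assms, of Y "X \<union> Y"] XY by (auto simp: forests_def)
    moreover have "X \<inter> leaves T = X" "Y \<inter> leaves T = Y" using XY by (auto simp: forests_def)
    ultimately show False using XY by simp
  qed
qed

fun tree_rank :: "'a sptree \<Rightarrow> nat" where
  "tree_rank (Leaf a) = 1"
| "tree_rank (Ser l r) = tree_rank l + tree_rank r"
| "tree_rank (Par l r) = tree_rank l + tree_rank r - 1"

lemma rank_in_leaves: "leaves T \<subseteq> X \<Longrightarrow> rank_in T X = tree_rank T"
  by (induction T) (auto simp: conn_leaves)

lemma tree_rank_pos: "tree_rank T > 0"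
  by (induction T) auto

lemma matroid_rank_forests:
  assumes "distinct_leaves T"
  shows "matroid_rank (forests T) = tree_rank T"
proof -
  have fin: "finite (forests T)"
    by (rule finite_subset[of _ "Pow (leaves T)"]) (auto simp: forests_def)
  have int: "F \<inter> leaves T = F" if "F \<in> forests T" for F using that by (auto simp: forests_def)
  have le: "card F \<le> tree_rank T" if "F \<in> forests T" for F
    using card_forest_le[OF assms, of F "leaves T"] that int[OF that]
    by (auto simp: forests_def rank_in_leaves)
  have "Max (card ` forests T) \<in> card ` forests T" using fin by (intro Max_in) (auto simp: forests_def)
  then obtain F where F: "F \<in> forests T" "\<And>G. G \<in> forests T \<Longrightarrow> card G \<le> card F"
    using fin by (metis Max_ge finite_imageI imageE image_eqI)
  have "card (F \<inter> leaves T) = rank_in T (leaves T)"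
  proof (rule card_maximal_forest(1)[THEN conjunct1, OF assms])
    show "forest T F" "F \<subseteq> leaves T" using F(1) by (auto simp: forests_def)
    show "\<forall>y\<in>leaves T \<inter> leaves T - F. \<not> forest T (insert y F)"
    proof (intro ballI notI)
      fix y assume y: "y \<in> leaves T \<inter> leaves T - F" "forest T (insert y F)"
      then have "insert y F \<in> forests T" using F(1) by (auto simp: forests_def)
      then have "card (insert y F) \<le> card F" by (rule F(2))
      moreover have "finite F" using F(1) by (auto simp: forests_def intro: finite_subset)
      ultimately show False using y by simp
    qed
  qed
  then have "card F = tree_rank T" using int[OF F(1)] by (simp add: rank_in_leaves)
  then have "tree_rank T \<in> card ` forests T" using F(1) by (metis image_eqI)
  then show ?thesis unfolding matroid_rank_def using le fin
    by (intro Max_eqI) auto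
qed

text \<open>Detects an edge that joins the two terminals directly, that is, a leaf with only
  parallel nodes above it. Such an edge would be parallel to \<open>e\<close>.\<close>

fun has_parallel_leaf :: "'a sptree \<Rightarrow> bool" where
  "has_parallel_leaf (Leaf a) = True"
| "has_parallel_leaf (Ser l r) = False"
| "has_parallel_leaf (Par l r) = (has_parallel_leaf l \<or> has_parallel_leaf r)"

fun simple_tree :: "'a sptree \<Rightarrow> bool" where
  "simple_tree (Leaf a) = True"
| "simple_tree (Ser l r) = (simple_tree l \<and> simple_tree r)"
| "simple_tree (Par l r) = (simple_tree l \<and> simple_tree r \<and> \<not> (has_parallel_leaf l \<and> has_parallel_leaf r))"

lemma conn_singleton_iff:
  assumes "distinct_leaves T"
  shows "(\<exists>a. conn T {a}) \<longleftrightarrow> has_parallel_leaf T"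
  using assms
proof (induction T)
  case (Ser l r)
  have "\<not> (conn l {a} \<and> conn r {a})" for a
  proof
    assume "conn l {a} \<and> conn r {a}"
    then have "a \<in> leaves l" "a \<in> leaves r"
      using not_conn_disjoint[of "{a}" l] not_conn_disjoint[of "{a}" r] by blast+
    then show False using Ser.prems by auto
  qed
  then show ?case by simp
next
  case (Par l r)
  then show ?case by (simp add: ex_disj_distrib)
qed simp

text \<open>A pair closes a cycle at a parallel node only if it connects both sides. These have
  disjoint leaves, so one element of the pair has to connect each side alone.\<close>

lemma forest_pairs_iff_simple_tree:
  assumes "distinct_leaves T"
  shows "(\<forall>a b. forest T {a, b}) \<longleftrightarrow> simple_tree T"
  using assms
proof (induction T)
  case (Ser l r)
  then show ?case by auto
next
  case (Par l r)
  have "(\<exists>a b. conn l {a, b} \<and> conn r {a, b}) \<longleftrightarrow> has_parallel_leaf l \<and> has_parallel_leaf r" (is "?L \<longleftrightarrow> ?R")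
  proof
    assume ?L
    then obtain a b where ab: "conn l {a, b}" "conn r {a, b}" by blast
    obtain x y where xy: "x \<in> {a, b} \<inter> leaves l" "y \<in> {a, b} \<inter> leaves r"
      using ab not_conn_disjoint by (metis ex_in_conv)
    then have "x \<notin> leaves r" "y \<notin> leaves l" using Par.prems by auto
    then have "{a, b} \<inter> leaves l = {x} \<inter> leaves l" "{a, b} \<inter> leaves r = {y} \<inter> leaves r"
      using xy by auto
    then have "conn l {x}" "conn r {y}" using ab conn_cong by metis+
    then show ?R using conn_singleton_iff Par.prems by auto
  next
    assume ?R
    then obtain a b where "conn l {a}" "conn r {b}"
      using conn_singleton_iff[of l] conn_singleton_iff[of r] Par.prems by auto
    then have "conn l {a, b}" "conn r {a, b}" by (auto elim: conn_mono)
    then show ?L by blast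
  qed
  then show ?case using Par by auto
qed auto

lemma (in matroid) simple_matroid_iff:
  "simple_matroid E \<I> \<longleftrightarrow> (\<forall>X\<subseteq>E. card X \<le> 2 \<longrightarrow> X \<in> \<I>)"
proof
  assume s: "simple_matroid E \<I>"
  show "\<forall>X\<subseteq>E. card X \<le> 2 \<longrightarrow> X \<in> \<I>"
  proof (intro allI impI)
    fix X assume X: "X \<subseteq> E" "card X \<le> 2"
    have fX: "finite X" using X finite_ground finite_subset by blast
    show "X \<in> \<I>"
    proof (rule ccontr)
      assume "X \<notin> \<I>"
      then obtain C where C: "C \<subseteq> X" "C \<notin> \<I>" "\<And>D. D \<subseteq> X \<Longrightarrow> D \<notin> \<I> \<Longrightarrow> card C \<le> card D"
        using ex_has_least_nat[of "\<lambda>C. C \<subseteq> X \<and> C \<notin> \<I>" X card] by blast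
      have "D \<in> \<I>" if "D \<subset> C" for D
        using psubset_card_mono[OF finite_subset[OF C(1) fX] that] C(3)[of D] C(1) that by force
      then have "matroid_circuit E \<I> C" using X C by (auto simp: matroid_circuit_def)
      then have "card C > 2" using s by (auto simp: simple_matroid_def)
      moreover have "card C \<le> card X" using C fX card_mono by blast
      ultimately show False using X by simp
    qed
  qed
next
  assume "\<forall>X\<subseteq>E. card X \<le> 2 \<longrightarrow> X \<in> \<I>"
  then show "simple_matroid E \<I>"
    unfolding simple_matroid_def matroid_circuit_def by (meson not_le)
qed

lemma simple_matroid_forests_iff:
  assumes "distinct_leaves T"
  shows "simple_matroid (leaves T) (forests T) \<longleftrightarrow> simple_tree T"
proof -
  have "(\<forall>X\<subseteq>leaves T. card X \<le> 2 \<longrightarrow> X \<in> forests T) \<longleftrightarrow> (\<forall>a b. forest T {a, b})" (is "?L \<longleftrightarrow> ?R")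
  proof
    assume L: ?L
    show ?R
    proof (intro allI)
      fix a b
      have "card ({a, b} \<inter> leaves T) \<le> card {a, b}" by (intro card_mono) auto
      also have "\<dots> \<le> 2" by (simp add: card_insert_if)
      finally have "{a, b} \<inter> leaves T \<in> forests T" using L by blast
      then have "forest T ({a, b} \<inter> leaves T)" by (simp add: forests_def)
      then show "forest T {a, b}" using forest_cong[of "{a, b} \<inter> leaves T" T "{a, b}"] by auto
    qed
  next
    assume R: ?R
    show ?L
    proof (intro allI impI)
      fix X assume X: "X \<subseteq> leaves T" "card X \<le> 2"
      have "\<exists>a b. X \<subseteq> {a, b}"
      proof -
        have "finite X" using X finite_subset by fastforce
        then consider "X = {}" | "card X = 1" | "card X = 2" using X(2) by (cases "card X"; cases "card X - 1") auto
        then show ?thesis by cases (auto simp: card_1_singleton_iff card_2_iff)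
      qed
      then show "X \<in> forests T" using R X forest_antimono unfolding forests_def by blast
    qed
  qed
  then show ?thesis
    using matroid.simple_matroid_iff[OF matroid_forests[OF assms]] forest_pairs_iff_simple_tree[OF assms] by simp
qed

lemma ex_connecting_forest:
  assumes "distinct_leaves T" "conn T X"
  shows "\<exists>F. F \<subseteq> X \<inter> leaves T \<and> forest T F \<and> conn T F"
  using assms
proof (induction T)
  case (Leaf a)
  then show ?case by (intro exI[of _ "{a}"]) simp
next
  case (Ser l r)
  from Ser.prems have c: "conn l X" "conn r X"
    and d: "distinct_leaves l" "distinct_leaves r" "leaves l \<inter> leaves r = {}" by simp_all
  obtain F where F: "F \<subseteq> X \<inter> leaves l" "forest l F" "conn l F"
    using Ser.IH(1)[OF d(1) c(1)] by blast
  obtain G where G: "G \<subseteq> X \<inter> leaves r" "forest r G" "conn r G"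
    using Ser.IH(2)[OF d(2) c(2)] by blast
  have I: "(F \<union> G) \<inter> leaves l = F \<inter> leaves l" "(F \<union> G) \<inter> leaves r = G \<inter> leaves r"
    using F(1) G(1) d(3) by blast+
  have "forest (Ser l r) (F \<union> G)" "conn (Ser l r) (F \<union> G)"
    using F(2,3) G(2,3) conn_cong[OF I(1)] conn_cong[OF I(2)] forest_cong[OF I(1)] forest_cong[OF I(2)]
    by simp_all
  moreover have "F \<union> G \<subseteq> X \<inter> leaves (Ser l r)" using F(1) G(1) by auto
  ultimately show ?case by blast
next
  case (Par l r)
  from Par.prems have d: "distinct_leaves l" "distinct_leaves r" "leaves l \<inter> leaves r = {}" by simp_all
  have "conn l X \<or> conn r X" using Par.prems by simp
  then show ?case
  proof
    assume "conn l X"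
    then obtain F where F: "F \<subseteq> X \<inter> leaves l" "forest l F" "conn l F"
      using Par.IH(1)[OF d(1)] by blast
    have "F \<inter> leaves r = {} \<inter> leaves r" using F(1) d(3) by blast
    then have "forest (Par l r) F" "conn (Par l r) F"
      using F forest_cong[of F r "{}"] conn_cong[of F r "{}"] by simp_all
    moreover have "F \<subseteq> X \<inter> leaves (Par l r)" using F(1) by auto
    ultimately show ?thesis by blast
  next
    assume "conn r X"
    then obtain F where F: "F \<subseteq> X \<inter> leaves r" "forest r F" "conn r F"
      using Par.IH(2)[OF d(2)] by blast
    have "F \<inter> leaves l = {} \<inter> leaves l" using F(1) d(3) by blast
    then have "forest (Par l r) F" "conn (Par l r) F"
      using F forest_cong[of F l "{}"] conn_cong[of F l "{}"] by simp_all
    moreover have "F \<subseteq> X \<inter> leaves (Par l r)" using F(1) by auto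
    ultimately show ?thesis by blast
  qed
qed

lemma conn_iff_forest_circuit:
  assumes "distinct_leaves T"
  shows "conn T X \<longleftrightarrow> (\<exists>F\<subseteq>X. F \<subseteq> leaves T \<and> forest T F \<and> conn T F)"
  using ex_connecting_forest[OF assms, of X] conn_mono[of T _ X] by (metis le_inf_iff)

text \<open>An independent set avoiding \<open>e\<close> becomes dependent on adding
  \<open>e\<close> exactly when it connects the terminals. The matroid thus determines the
  connecting forests, and every connecting set contains one of them.\<close>

lemma forests_Par_Leaf_eqD:
  assumes T: "distinct_leaves T" and T': "distinct_leaves T'"
    and lv: "leaves T = leaves T'" "e \<notin> leaves T"
    and eq: "forests (Par T (Leaf e)) = forests (Par T' (Leaf e))"
  shows "conn T X = conn T' X"
proof -
  have "conn U X \<longleftrightarrow> (\<exists>F\<subseteq>X. F \<subseteq> leaves U \<and>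
      F \<in> forests (Par U (Leaf e)) \<and> insert e F \<notin> forests (Par U (Leaf e)))"
    if "e \<notin> leaves U" "distinct_leaves U" for U
  proof -
    have "F \<subseteq> leaves U \<and> forest U F \<and> conn U F \<longleftrightarrow> F \<subseteq> leaves U \<and>
        F \<in> forests (Par U (Leaf e)) \<and> insert e F \<notin> forests (Par U (Leaf e))" for F
      using that(1) by (auto simp: forests_def)
    then show ?thesis by (subst conn_iff_forest_circuit[OF that(2)]) simp
  qed
  from this[OF lv(2) T] this[OF _ T'] show ?thesis using lv eq by simp
qed

section \<open>Uniqueness and existence of normal forms\<close>

text \<open>
  For the connectivity function of a network this says that some minimal connecting set contains
  both elements; it never happens across a parallel node and always across a series node.
\<close>

definition linked :: "('a set \<Rightarrow> bool) \<Rightarrow> 'a \<Rightarrow> 'a \<Rightarrow> bool" where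
  "linked f a b \<longleftrightarrow> (\<exists>X. f X \<and> \<not> f (X - {a}) \<and> \<not> f (X - {b}))"

lemma linked_sym: "linked f a b \<Longrightarrow> linked f b a"
  by (auto simp: linked_def)

text \<open>A read-once function depends on each of its variables: start from a critical set in the
  child containing \<open>a\<close> and include all of the sibling at a series node, nothing of it
  at a parallel node.\<close>

lemma ex_critical_set:
  assumes "distinct_leaves T" "a \<in> leaves T"
  shows "\<exists>X\<subseteq>leaves T. conn T X \<and> \<not> conn T (X - {a})"
  using assms
proof (induction T)
  case (Leaf b)
  then show ?case by (intro exI[of _ "{a}"]) simp
next
  have aux: "\<exists>X\<subseteq>leaves l \<union> leaves r. conn (Ser l r) X \<and> \<not> conn (Ser l r) (X - {a})"
    if "leaves l \<inter> leaves r = {}" and X: "X \<subseteq> leaves l" "conn l X" "\<not> conn l (X - {a})"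
    for l r :: "'a sptree" and X
  proof (intro exI[of _ "X \<union> leaves r"] conjI)
    have "(X \<union> leaves r - {a}) \<inter> leaves l = (X - {a}) \<inter> leaves l" using that by blast
    then show "\<not> conn (Ser l r) (X \<union> leaves r - {a})" using X(3) conn_cong by fastforce
    show "conn (Ser l r) (X \<union> leaves r)"
      using X(2) conn_mono[of l X "X \<union> leaves r"] conn_leaves[of r "X \<union> leaves r"] by simp
  qed (use X(1) in blast)
  case (Ser l r)
  then have d: "distinct_leaves l" "distinct_leaves r" "leaves l \<inter> leaves r = {}" by simp_all
  show ?case
  proof (cases "a \<in> leaves l")
    case True
    then show ?thesis using Ser.IH(1)[OF d(1)] aux[OF d(3)] by (metis leaves.simps(2))
  next
    case False
    then have "a \<in> leaves r" using Ser.prems by simp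
    then obtain X where "X \<subseteq> leaves r" "conn r X" "\<not> conn r (X - {a})" using Ser.IH(2)[OF d(2)] by blast
    then have "\<exists>X\<subseteq>leaves r \<union> leaves l. conn (Ser r l) X \<and> \<not> conn (Ser r l) (X - {a})"
      using aux[of r l X] d(3) by blast
    then show ?thesis by (simp add: Un_commute conj_commute)
  qed
next
  have aux: "\<not> conn r X \<and> \<not> conn r (X - {a})"
    if "leaves l \<inter> leaves r = {}" and X: "X \<subseteq> leaves l" for l r :: "'a sptree" and X
    using not_conn_disjoint[of X r] not_conn_disjoint[of "X - {a}" r] that by blast
  case (Par l r)
  then have d: "distinct_leaves l" "distinct_leaves r" "leaves l \<inter> leaves r = {}" by simp_all
  have "a \<in> leaves l \<or> a \<in> leaves r" using Par.prems by simp
  then show ?case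
  proof
    assume "a \<in> leaves l"
    then obtain X where "X \<subseteq> leaves l" "conn l X" "\<not> conn l (X - {a})" using Par.IH(1)[OF d(1)] by blast
    then show ?thesis using aux[OF d(3)] by (intro exI[of _ X]) auto
  next
    assume "a \<in> leaves r"
    then obtain X where "X \<subseteq> leaves r" "conn r X" "\<not> conn r (X - {a})" using Par.IH(2)[OF d(2)] by blast
    then show ?thesis using aux[of r l X] d(3) by (intro exI[of _ X]) auto
  qed
qed

text \<open>The union of a set critical for \<open>a\<close> on the left and one critical for
  \<open>b\<close> on the right is a witness.\<close>

lemma linked_Ser:
  assumes "distinct_leaves (Ser l r)" "a \<in> leaves l" "b \<in> leaves r"
  shows "linked (conn (Ser l r)) a b"
proof -
  have d: "distinct_leaves l" "distinct_leaves r" "leaves l \<inter> leaves r = {}" using assms(1) by simp_all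
  obtain X where X: "X \<subseteq> leaves l" "conn l X" "\<not> conn l (X - {a})"
    using ex_critical_set[OF d(1) assms(2)] by blast
  obtain Y where Y: "Y \<subseteq> leaves r" "conn r Y" "\<not> conn r (Y - {b})"
    using ex_critical_set[OF d(2) assms(3)] by blast
  have "(X \<union> Y - {a}) \<inter> leaves l = (X - {a}) \<inter> leaves l" "(X \<union> Y - {b}) \<inter> leaves r = (Y - {b}) \<inter> leaves r"
    using X(1) Y(1) d(3) by blast+
  then have "\<not> conn l (X \<union> Y - {a})" "\<not> conn r (X \<union> Y - {b})"
    using X(3) Y(3) conn_cong[of "X \<union> Y - {a}" l "X - {a}"] conn_cong[of "X \<union> Y - {b}" r "Y - {b}"] by simp_all
  moreover have "conn l (X \<union> Y)" "conn r (X \<union> Y)"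
    using X(2) Y(2) by (auto elim: conn_mono)
  ultimately show ?thesis unfolding linked_def by (intro exI[of _ "X \<union> Y"]) simp
qed

lemma not_linked_Par:
  assumes "distinct_leaves (Par l r)" "a \<in> leaves l" "b \<in> leaves r"
  shows "\<not> linked (conn (Par l r)) a b"
proof -
  have "b \<notin> leaves l" "a \<notin> leaves r" using assms by auto
  then show ?thesis by (auto simp: linked_def)
qed

text \<open>Cutting the witness down to \<open>leaves l\<close> keeps the right side disconnected,
  so the node behaves like \<open>l\<close> on it.\<close>

lemma linked_Par_left:
  assumes "distinct_leaves (Par l r)" "linked (conn l) a b"
  shows "linked (conn (Par l r)) a b"
proof -
  obtain X where X: "conn l X" "\<not> conn l (X - {a})" "\<not> conn l (X - {b})"
    using assms(2) by (auto simp: linked_def)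
  have d: "leaves l \<inter> leaves r = {}" using assms(1) by simp
  have r: "\<not> conn r (X \<inter> leaves l - Z)" for Z
    using not_conn_disjoint[of "X \<inter> leaves l - Z" r] d by blast
  have l: "conn l (X \<inter> leaves l - Z) = conn l (X - Z)" for Z
    by (rule conn_cong) blast
  show ?thesis unfolding linked_def
    using r l[of "{}"] l[of "{a}"] l[of "{b}"] X by (intro exI[of _ "X \<inter> leaves l"]) simp
qed

text \<open>At a series node every leaf on the left is linked to every leaf on the right. This
  complete bipartite graph is connected, so the leaves cannot be divided without separating a linked
  pair.\<close>

lemma linked_connected:
  assumes "distinct_leaves T" "\<not> is_Par T" "leaves T \<subseteq> A \<union> B"
    and no: "\<And>a b. a \<in> A \<inter> leaves T \<Longrightarrow> b \<in> B \<inter> leaves T \<Longrightarrow> \<not> linked (conn T) a b"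
  shows "leaves T \<subseteq> A \<or> leaves T \<subseteq> B"
proof (cases T)
  case (Leaf a)
  then show ?thesis using assms(3) by auto
next
  case (Ser l r)
  have L: "linked (conn T) a b" if "a \<in> leaves l" "b \<in> leaves r" for a b
    unfolding Ser by (rule linked_Ser[OF assms(1)[unfolded Ser] that])
  have no': "\<not> linked (conn T) b a" if "a \<in> A \<inter> leaves T" "b \<in> B \<inter> leaves T" for a b
    using no that linked_sym by metis
  have lr: "leaves T = leaves l \<union> leaves r" using Ser by simp
  show ?thesis
  proof (rule ccontr)
    assume "\<not> ?thesis"
    then obtain z b where zb: "z \<in> A \<inter> leaves T" "z \<notin> B" "b \<in> B \<inter> leaves T" "b \<notin> A" using assms(3) by blast
    obtain cl cr where c: "cl \<in> leaves l" "cr \<in> leaves r" using leaves_nonempty by (metis ex_in_conv)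
    have cc: "cl \<in> A \<inter> leaves T \<or> cl \<in> B \<inter> leaves T" "cr \<in> A \<inter> leaves T \<or> cr \<in> B \<inter> leaves T" using c lr assms(3) by auto
    consider "z \<in> leaves l" "b \<in> leaves l" | "z \<in> leaves l" "b \<in> leaves r" | "z \<in> leaves r" "b \<in> leaves l"
      | "z \<in> leaves r" "b \<in> leaves r" using zb lr by blast
    then show False
    proof cases
      case 1
      then have "linked (conn T) z cr" "linked (conn T) b cr" using L c by auto
      then show False using cc zb no no' by meson
    next
      case 2 then show False using L no zb by blast
    next
      case 3 then show False using L no' zb by blast
    next
      case 4
      then have "linked (conn T) cl z" "linked (conn T) cl b" using L c by auto
      then show False using cc zb no no' by meson
    qed
  qed
qed (use assms in simp)

text \<open>Links inside \<open>l\<close> persist in the whole tree, where no link crosses the other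
  parallel decomposition; hence \<open>l\<close> lies on one side of it.\<close>

lemma Par_block_subset:
  assumes T: "distinct_leaves (Par l r)" and T': "distinct_leaves (Par l' r')"
    and lv: "leaves (Par l r) = leaves (Par l' r')" and eq: "conn (Par l r) = conn (Par l' r')"
    and l: "\<not> is_Par l" and meet: "leaves l \<inter> leaves l' \<noteq> {}"
  shows "leaves l \<subseteq> leaves l'"
proof -
  have dl: "distinct_leaves l" and sub: "leaves l \<subseteq> leaves l' \<union> leaves r'" using T lv by auto
  have "\<not> linked (conn l) a b" if "a \<in> leaves l' \<inter> leaves l" "b \<in> leaves r' \<inter> leaves l" for a b
    using linked_Par_left[OF T, of a b] not_linked_Par[OF T', of a b] that eq by auto
  then have "leaves l \<subseteq> leaves l' \<or> leaves l \<subseteq> leaves r'"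
    using linked_connected[OF dl l sub] by blast
  then show ?thesis using meet T' by auto
qed

lemma Par_block_eq:
  assumes T: "distinct_leaves (Par l r)" and T': "distinct_leaves (Par l' r')"
    and lv: "leaves (Par l r) = leaves (Par l' r')" and eq: "conn (Par l r) = conn (Par l' r')"
    and l: "\<not> is_Par l" "\<not> is_Par l'" and meet: "leaves l \<inter> leaves l' \<noteq> {}"
  shows "leaves l = leaves l' \<and> leaves r = leaves r'"
proof -
  have "leaves l = leaves l'"
    using Par_block_subset[OF T T' lv eq l(1) meet] Par_block_subset[OF T' T lv[symmetric] eq[symmetric] l(2)] meet
    by (simp add: Int_commute subset_antisym)
  moreover have "leaves r = leaves (Par l r) - leaves l" "leaves r' = leaves (Par l' r') - leaves l'"
    using T T' by auto
  ultimately show ?thesis using lv by simp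
qed

text \<open>The series case of the uniqueness proof is reduced to the parallel case by duality.\<close>

fun dual :: "'a sptree \<Rightarrow> 'a sptree" where
  "dual (Leaf a) = Leaf a"
| "dual (Ser l r) = Par (dual l) (dual r)"
| "dual (Par l r) = Ser (dual l) (dual r)"

lemma leaves_dual [simp]: "leaves (dual T) = leaves T"
  by (induction T) auto

lemma distinct_leaves_dual [simp]: "distinct_leaves (dual T) = distinct_leaves T"
  by (induction T) auto

text \<open>De Morgan: exchanging series and parallel turns connecting sets into complements of sets
  that do not connect, as for paths and cuts in planar duality.\<close>

lemma conn_dual: "conn (dual T) X \<longleftrightarrow> \<not> conn T (- X)"
  by (induction T) auto

lemma is_Par_dual [simp]: "is_Par (dual T) = is_Ser T"
  by (cases T) auto

lemma Ser_block_eq: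
  assumes "distinct_leaves (Ser l r)" "distinct_leaves (Ser l' r')"
    and "leaves (Ser l r) = leaves (Ser l' r')" and eq: "conn (Ser l r) = conn (Ser l' r')"
    and "\<not> is_Ser l" "\<not> is_Ser l'" "leaves l \<inter> leaves l' \<noteq> {}"
  shows "leaves l = leaves l' \<and> leaves r = leaves r'"
proof -
  have "conn (Par (dual l) (dual r)) = conn (Par (dual l') (dual r'))"
    using fun_cong[OF eq] by (auto simp: conn_dual fun_eq_iff)
  then show ?thesis using Par_block_eq[of "dual l" "dual r" "dual l'" "dual r'"] assms by simp
qed

text \<open>Links hold all leaves of a series node together, while they never cross a parallel
  node.\<close>

lemma conn_Ser_neq_conn_Par:
  assumes "distinct_leaves (Ser l r)" "distinct_leaves (Par l' r')"
    and "leaves (Ser l r) = leaves (Par l' r')"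
  shows "conn (Ser l r) \<noteq> conn (Par l' r')"
proof
  assume eq: "conn (Ser l r) = conn (Par l' r')"
  have "leaves (Ser l r) \<subseteq> leaves l' \<or> leaves (Ser l r) \<subseteq> leaves r'"
  proof (rule linked_connected[OF assms(1)])
    show "leaves (Ser l r) \<subseteq> leaves l' \<union> leaves r'" using assms(3) by simp
    show "\<not> linked (conn (Ser l r)) a b" if "a \<in> leaves l' \<inter> leaves (Ser l r)" "b \<in> leaves r' \<inter> leaves (Ser l r)" for a b
      unfolding eq using not_linked_Par[OF assms(2)] that by blast
  qed simp
  then have "leaves l' \<union> leaves r' \<subseteq> leaves l' \<or> leaves l' \<union> leaves r' \<subseteq> leaves r'"
    unfolding assms(3) by simp
  moreover have "leaves l' \<inter> leaves r' = {}" using assms(2) by simp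
  ultimately show False using leaves_nonempty[of l'] leaves_nonempty[of r'] by blast
qed

text \<open>
  The children of a node are listed from left to right along a right comb. The order starts with
  the block containing the smallest element, except that the parallel leaf, of which a simple tree
  has at most one at each node, comes first.
\<close>

fun normal :: "'a::linorder sptree \<Rightarrow> bool" where
  "normal (Leaf a) = True"
| "normal (Ser l r) = (normal l \<and> normal r \<and> \<not> is_Ser l \<and> Min (leaves l \<union> leaves r) \<in> leaves l)"
| "normal (Par l r) = (normal l \<and> normal r \<and> \<not> has_parallel_leaf r \<and>
    (is_Leaf l \<or> is_Ser l \<and> Min (leaves l \<union> leaves r) \<in> leaves l))"

lemma leaves_Un_neq_singleton:
  assumes "leaves l \<inter> leaves r = {}"
  shows "leaves l \<union> leaves r \<noteq> {a}"
proof
  assume "leaves l \<union> leaves r = {a}"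
  moreover obtain x y where "x \<in> leaves l" "y \<in> leaves r" using leaves_nonempty by (metis ex_in_conv)
  ultimately have "x = a" "y = a" by blast+
  then show False using \<open>x \<in> leaves l\<close> \<open>y \<in> leaves r\<close> assms by blast
qed

lemma conn_restrict:
  assumes "leaves l \<inter> leaves r = {}"
  shows "conn (Ser l r) (X \<inter> leaves l \<union> leaves r) = conn l X"
    and "conn (Ser l r) (X \<inter> leaves r \<union> leaves l) = conn r X"
    and "conn (Par l r) (X \<inter> leaves l) = conn l X"
    and "conn (Par l r) (X \<inter> leaves r) = conn r X"
proof -
  have "conn l (X \<inter> leaves l \<union> leaves r) = conn l X" "conn r (X \<inter> leaves r \<union> leaves l) = conn r X"
    "conn l (X \<inter> leaves l) = conn l X" "conn r (X \<inter> leaves r) = conn r X"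
    by (rule conn_cong, use assms in blast)+
  moreover have "conn r (X \<inter> leaves l \<union> leaves r)" "conn l (X \<inter> leaves r \<union> leaves l)"
    by (rule conn_leaves, blast)+
  moreover have "\<not> conn r (X \<inter> leaves l)" "\<not> conn l (X \<inter> leaves r)"
    by (rule not_conn_disjoint, use assms in blast)+
  ultimately show "conn (Ser l r) (X \<inter> leaves l \<union> leaves r) = conn l X"
    and "conn (Ser l r) (X \<inter> leaves r \<union> leaves l) = conn r X"
    and "conn (Par l r) (X \<inter> leaves l) = conn l X"
    and "conn (Par l r) (X \<inter> leaves r) = conn r X"
    by simp_all
qed

text \<open>A single element cannot connect a network without a parallel leaf, so the leaf
  \<open>a\<close> has to occur in the left part. This is where placing the parallel leaf first pays
  off.\<close>

lemma leaf_in_left_part: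
  assumes eq: "conn (Par (Leaf a) V) = conn (Par W Z)" and d: "distinct_leaves Z" "\<not> has_parallel_leaf Z"
  shows "a \<in> leaves W"
proof -
  have "conn (Par W Z) {a}" unfolding eq[symmetric] by simp
  moreover have "\<not> conn Z {a}" using conn_singleton_iff[OF d(1)] d(2) by blast
  ultimately have "conn W {a}" by simp
  then show ?thesis using not_conn_disjoint[of "{a}" W] by blast
qed

text \<open>The root types agree because links distinguish them. The left children are blocks that
  cannot be divided, so as soon as they meet they have the same leaves; the functions of the
  children are then recovered by filling (series) or emptying (parallel) the sibling.\<close>

lemma normal_eqI:
  assumes "normal T" "normal U" "distinct_leaves T" "distinct_leaves U" "leaves T = leaves U" "conn T = conn U"
  shows "T = U"
  using assms
proof (induction T arbitrary: U)
  case (Leaf a)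
  show ?case
  proof (cases U)
    case (Leaf b)
    then show ?thesis using Leaf.prems by simp
  next
    case (Ser l r)
    then show ?thesis using leaves_Un_neq_singleton[of l r a] Leaf.prems by simp
  next
    case (Par l r)
    then show ?thesis using leaves_Un_neq_singleton[of l r a] Leaf.prems by simp
  qed
next
  case (Ser l r)
  show ?case
  proof (cases U)
    case (Leaf a)
    then show ?thesis using leaves_Un_neq_singleton[of l r a] Ser.prems by simp
  next
    case (Par l' r')
    note prems = Ser.prems[unfolded Par]
    show ?thesis using conn_Ser_neq_conn_Par[OF prems(3-5)] prems(6) by contradiction
  next
    case U: (Ser l' r')
    note prems = Ser.prems[unfolded U]
    have "Min (leaves l \<union> leaves r) \<in> leaves l \<inter> leaves l'" using prems(1,2,5) by simp
    then have lv: "leaves l = leaves l'" "leaves r = leaves r'"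
      using Ser_block_eq[OF prems(3-6)] prems(1,2) by auto
    have d: "leaves l \<inter> leaves r = {}" "leaves l' \<inter> leaves r' = {}" using prems(3,4) by simp_all
    have "conn l = conn l'"
    proof
      show "conn l X = conn l' X" for X
        using fun_cong[OF prems(6), of "X \<inter> leaves l \<union> leaves r"] conn_restrict(1)[OF d(1), of X]
          conn_restrict(1)[OF d(2), of X] lv by (simp del: conn.simps)
    qed
    moreover have "conn r = conn r'"
    proof
      show "conn r X = conn r' X" for X
        using fun_cong[OF prems(6), of "X \<inter> leaves r \<union> leaves l"] conn_restrict(2)[OF d(1), of X]
          conn_restrict(2)[OF d(2), of X] lv by (simp del: conn.simps)
    qed
    ultimately show ?thesis unfolding U using Ser.IH(1)[of l'] Ser.IH(2)[of r'] lv prems(1-4) by simp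
  qed
next
  case (Par l r)
  show ?case
  proof (cases U)
    case (Leaf a)
    then show ?thesis using leaves_Un_neq_singleton[of l r a] Par.prems by simp
  next
    case (Ser l' r')
    note prems = Par.prems[unfolded Ser]
    show ?thesis using conn_Ser_neq_conn_Par[OF prems(4,3) prems(5)[symmetric]] prems(6)[symmetric] by contradiction
  next
    case U: (Par l' r')
    note prems = Par.prems[unfolded U]
    \<comment> \<open>A parallel leaf of one tree must appear in the left child of the other; if
      neither left child is a leaf, both contain the overall minimum.\<close>
    have meet: "leaves l \<inter> leaves l' \<noteq> {}"
    proof (cases "is_Leaf l \<or> is_Leaf l'")
      case True
      then show ?thesis
      proof
        assume "is_Leaf l"
        then obtain a where l: "l = Leaf a" by (auto simp: is_Leaf_def)
        have "a \<in> leaves l'" using leaf_in_left_part[OF prems(6)[unfolded l]] prems(2,4) by simp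
        then show ?thesis unfolding l by simp
      next
        assume "is_Leaf l'"
        then obtain a where l: "l' = Leaf a" by (auto simp: is_Leaf_def)
        have "a \<in> leaves l" using leaf_in_left_part[OF prems(6)[symmetric, unfolded l]] prems(1,3) by simp
        then show ?thesis unfolding l by simp
      qed
    next
      case False
      then have "Min (leaves l \<union> leaves r) \<in> leaves l \<inter> leaves l'" using prems(1,2,5) by simp
      then show ?thesis by blast
    qed
    have np: "\<not> is_Par l" "\<not> is_Par l'" using prems(1) prems(2) by (auto simp: is_Par_def)
    have lv: "leaves l = leaves l'" "leaves r = leaves r'"
      using Par_block_eq[OF prems(3-6) np meet] by blast+
    have d: "leaves l \<inter> leaves r = {}" "leaves l' \<inter> leaves r' = {}" using prems(3,4) by simp_all
    have "conn l = conn l'"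
    proof
      show "conn l X = conn l' X" for X
        using fun_cong[OF prems(6), of "X \<inter> leaves l"] conn_restrict(3)[OF d(1), of X]
          conn_restrict(3)[OF d(2), of X] lv by (simp del: conn.simps)
    qed
    moreover have "conn r = conn r'"
    proof
      show "conn r X = conn r' X" for X
        using fun_cong[OF prems(6), of "X \<inter> leaves r"] conn_restrict(4)[OF d(1), of X]
          conn_restrict(4)[OF d(2), of X] lv by (simp del: conn.simps)
    qed
    ultimately show ?thesis unfolding U using Par.IH(1)[of l'] Par.IH(2)[of r'] lv prems(1-4) by simp
  qed
qed

section \<open>Existence of normal forms\<close>

definition sp_equiv :: "'a sptree \<Rightarrow> 'a sptree \<Rightarrow> bool" where
  "sp_equiv T U \<longleftrightarrow> distinct_leaves T \<and> distinct_leaves U \<and> leaves T = leaves U \<and>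
    (\<forall>X. conn T X = conn U X \<and> forest T X = forest U X)"

lemma sp_equiv_refl: "distinct_leaves T \<Longrightarrow> sp_equiv T T"
  by (simp add: sp_equiv_def)

lemma sp_equiv_trans: "sp_equiv T U \<Longrightarrow> sp_equiv U V \<Longrightarrow> sp_equiv T V"
  by (simp add: sp_equiv_def)

lemma sp_equiv_commute:
  "distinct_leaves (Ser l r) \<Longrightarrow> sp_equiv (Ser l r) (Ser r l)"
  "distinct_leaves (Par l r) \<Longrightarrow> sp_equiv (Par l r) (Par r l)"
  by (auto simp: sp_equiv_def)

lemma sp_equiv_Ser_assoc:
  assumes "distinct_leaves (Ser (Ser T U) V)"
  shows "sp_equiv (Ser (Ser T U) V) (Ser T (Ser U V))"
proof -
  have "conn (Ser (Ser T U) V) X = conn (Ser T (Ser U V)) X"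
    "forest (Ser (Ser T U) V) X = forest (Ser T (Ser U V)) X" for X
    by simp_all
  moreover have "leaves (Ser (Ser T U) V) = leaves (Ser T (Ser U V))" by auto
  moreover have "distinct_leaves (Ser T (Ser U V))"
    using assms by (simp add: Int_Un_distrib Int_Un_distrib2)
  ultimately show ?thesis using assms unfolding sp_equiv_def by blast
qed

lemma sp_equiv_Par_assoc:
  assumes "distinct_leaves (Par (Par T U) V)"
  shows "sp_equiv (Par (Par T U) V) (Par T (Par U V))"
proof -
  have "conn (Par (Par T U) V) X = conn (Par T (Par U V)) X"
    "forest (Par (Par T U) V) X = forest (Par T (Par U V)) X" for X
    by (cases "conn T X"; cases "conn U X"; cases "conn V X"; simp)+
  moreover have "leaves (Par (Par T U) V) = leaves (Par T (Par U V))" by auto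
  moreover have "distinct_leaves (Par T (Par U V))"
    using assms by (simp add: Int_Un_distrib Int_Un_distrib2)
  ultimately show ?thesis using assms unfolding sp_equiv_def by blast
qed

text \<open>The reason for including \<open>conn\<close> in \<open>sp_equiv\<close>: whether a set
  is a forest at a parallel node depends on the connectivity of the children.\<close>

lemma sp_equiv_cong:
  assumes "sp_equiv l l'" "sp_equiv r r'" "leaves l \<inter> leaves r = {}"
  shows "sp_equiv (Ser l r) (Ser l' r')" "sp_equiv (Par l r) (Par l' r')"
  using assms by (auto simp: sp_equiv_def)

lemma sp_equiv_has_parallel_leaf:
  assumes "sp_equiv T U"
  shows "has_parallel_leaf T = has_parallel_leaf U"
proof -
  have "conn T {a} = conn U {a}" for a using assms unfolding sp_equiv_def by blast
  moreover have "distinct_leaves T" "distinct_leaves U" using assms unfolding sp_equiv_def by blast+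
  ultimately show ?thesis by (simp flip: conn_singleton_iff)
qed

lemma Min_Un_left:
  fixes A B :: "'a::linorder set"
  assumes "finite A" "finite B" "Min (A \<union> B) \<in> A"
  shows "Min A = Min (A \<union> B)"
  using assms by (intro Min_eqI) auto

text \<open>After a swap the minimum is on the left. If the left tree is itself a series node, its
  first block is pulled out by associativity and the rest is merged with the right tree, which
  lowers the total size.\<close>

lemma ex_normal_Ser:
  fixes a b :: "'a::linorder sptree"
  assumes "normal a" "normal b" "distinct_leaves (Ser a b)"
  shows "\<exists>c. normal c \<and> sp_equiv (Ser a b) c"
  using assms
proof (induction "size a + size b" arbitrary: a b rule: less_induct)
  case less
  have *: "\<exists>c. normal c \<and> sp_equiv (Ser x y) c"
    if xy: "size x + size y = size a + size b" "normal x" "normal y" "distinct_leaves (Ser x y)"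
      and m: "Min (leaves x \<union> leaves y) \<in> leaves x" for x y :: "'a sptree"
  proof (cases "is_Ser x")
    case False
    then show ?thesis using xy m by (intro exI[of _ "Ser x y"]) (simp add: sp_equiv_refl)
  next
    case True
    then obtain x1 x2 where x: "x = Ser x1 x2" by (auto simp: is_Ser_def)
    have "distinct_leaves (Ser x2 y)" using xy(4) unfolding x by auto
    then obtain c where c: "normal c" "sp_equiv (Ser x2 y) c"
      using less(1)[of x2 y] xy unfolding x by auto
    have lc: "leaves c = leaves x2 \<union> leaves y" using c(2) by (simp add: sp_equiv_def)
    have "Min (leaves x) \<in> leaves x1" using xy(2) unfolding x by simp
    then have "Min (leaves x \<union> leaves y) \<in> leaves x1" using Min_Un_left[OF _ _ m] by simp
    then have "normal (Ser x1 c)" using c(1) xy(2) unfolding x by (simp add: lc Un_assoc)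
    moreover have "sp_equiv (Ser x y) (Ser x1 (Ser x2 y))"
      using sp_equiv_Ser_assoc xy(4) unfolding x by blast
    moreover have "sp_equiv (Ser x1 (Ser x2 y)) (Ser x1 c)"
      using xy(4) unfolding x by (intro sp_equiv_cong sp_equiv_refl c(2)) auto
    ultimately show ?thesis using sp_equiv_trans by blast
  qed
  have "Min (leaves a \<union> leaves b) \<in> leaves a \<union> leaves b" by (intro Min_in) auto
  then show ?case
  proof
    assume "Min (leaves a \<union> leaves b) \<in> leaves a"
    then show ?thesis using *[of a b] less by blast
  next
    assume "Min (leaves a \<union> leaves b) \<in> leaves b"
    then have "\<exists>c. normal c \<and> sp_equiv (Ser b a) c"
      using *[of b a] less by (auto simp: Un_commute)
    then show ?thesis using sp_equiv_commute(1)[OF less(4)] sp_equiv_trans by blast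
  qed
qed

lemma ex_normal_Par:
  fixes a b :: "'a::linorder sptree"
  assumes "normal a" "normal b" "distinct_leaves (Par a b)" "\<not> has_parallel_leaf a" "\<not> has_parallel_leaf b"
  shows "\<exists>c. normal c \<and> sp_equiv (Par a b) c"
  using assms
proof (induction "size a + size b" arbitrary: a b rule: less_induct)
  case less
  have *: "\<exists>c. normal c \<and> sp_equiv (Par x y) c"
    if xy: "size x + size y = size a + size b" "normal x" "normal y" "distinct_leaves (Par x y)"
      "\<not> has_parallel_leaf x" "\<not> has_parallel_leaf y"
      and m: "Min (leaves x \<union> leaves y) \<in> leaves x" for x y :: "'a sptree"
  proof (cases x)
    case (Leaf a)
    then show ?thesis using xy by simp
  next
    case (Ser x1 x2)
    then show ?thesis using xy m by (intro exI[of _ "Par x y"]) (simp add: sp_equiv_refl)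
  next
    case x: (Par x1 x2)
    have "distinct_leaves (Par x2 y)" using xy(4) unfolding x by auto
    then obtain c where c: "normal c" "sp_equiv (Par x2 y) c"
      using less(1)[of x2 y] xy unfolding x by auto
    have hc: "\<not> has_parallel_leaf c" using sp_equiv_has_parallel_leaf[OF c(2)] xy unfolding x by simp
    have lc: "leaves c = leaves x2 \<union> leaves y" using c(2) by (simp add: sp_equiv_def)
    have x1: "is_Ser x1" using xy(2,5) unfolding x by (cases x1) auto
    then have "Min (leaves x) \<in> leaves x1" using xy(2) unfolding x by (cases x1) auto
    then have "Min (leaves x \<union> leaves y) \<in> leaves x1" using Min_Un_left[OF _ _ m] by simp
    then have "normal (Par x1 c)" using c(1) hc x1 xy(2) unfolding x by (simp add: lc Un_assoc)
    moreover have "sp_equiv (Par x y) (Par x1 (Par x2 y))"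
      using sp_equiv_Par_assoc xy(4) unfolding x by blast
    moreover have "sp_equiv (Par x1 (Par x2 y)) (Par x1 c)"
      using xy(4) unfolding x by (intro sp_equiv_cong sp_equiv_refl c(2)) auto
    ultimately show ?thesis using sp_equiv_trans by blast
  qed
  have "Min (leaves a \<union> leaves b) \<in> leaves a \<union> leaves b" by (intro Min_in) auto
  then show ?case
  proof
    assume "Min (leaves a \<union> leaves b) \<in> leaves a"
    then show ?thesis using *[of a b] less by blast
  next
    assume "Min (leaves a \<union> leaves b) \<in> leaves b"
    then have "\<exists>c. normal c \<and> sp_equiv (Par b a) c"
      using *[of b a] less by (auto simp: Un_commute)
    then show ?thesis using sp_equiv_commute(2)[OF less(4)] sp_equiv_trans by blast
  qed
qed

text \<open>If \<open>a\<close> has a parallel leaf, its normal form lists that leaf first. It can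
  stay in front while the remaining parts, now free of parallel leaves, are merged.\<close>

lemma ex_normal_Par':
  fixes a b :: "'a::linorder sptree"
  assumes ab: "normal a" "normal b" "distinct_leaves (Par a b)" "\<not> has_parallel_leaf b"
  shows "\<exists>c. normal c \<and> sp_equiv (Par a b) c"
proof (cases "has_parallel_leaf a")
  case False
  then show ?thesis using ex_normal_Par ab by blast
next
  case True
  show ?thesis
  proof (cases a)
    case (Leaf x)
    then show ?thesis using ab by (intro exI[of _ "Par a b"]) (simp add: sp_equiv_refl)
  next
    case (Ser x1 x2)
    then show ?thesis using True by simp
  next
    case a: (Par x1 x2)
    have h: "\<not> has_parallel_leaf x2" "is_Leaf x1"
      using ab(1) True unfolding a by (cases x1; simp)+
    have d: "distinct_leaves (Par x2 b)" using ab(3) unfolding a by auto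
    obtain c where c: "normal c" "sp_equiv (Par x2 b) c"
      using ex_normal_Par[OF _ ab(2) d] ab h unfolding a by auto
    have "\<not> has_parallel_leaf c" using sp_equiv_has_parallel_leaf[OF c(2)] h ab by simp
    then have "normal (Par x1 c)" using c(1) h ab(1) unfolding a by simp
    moreover have "sp_equiv (Par a b) (Par x1 (Par x2 b))"
      using sp_equiv_Par_assoc ab(3) unfolding a by blast
    moreover have "sp_equiv (Par x1 (Par x2 b)) (Par x1 c)"
      using ab(3) unfolding a by (intro sp_equiv_cong sp_equiv_refl c(2)) auto
    ultimately show ?thesis using sp_equiv_trans by blast
  qed
qed

lemma ex_normal:
  fixes T :: "'a::linorder sptree"
  assumes "distinct_leaves T" "simple_tree T"
  shows "\<exists>c. normal c \<and> sp_equiv T c"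
  using assms
proof (induction T)
  case (Leaf a)
  then show ?case by (intro exI[of _ "Leaf a"]) (simp add: sp_equiv_refl)
next
  case (Ser l r)
  then obtain a b where ab: "normal a" "sp_equiv l a" "normal b" "sp_equiv r b" by auto
  have e: "sp_equiv (Ser l r) (Ser a b)" using ab Ser.prems by (intro sp_equiv_cong) auto
  then have "distinct_leaves (Ser a b)" by (simp add: sp_equiv_def)
  then show ?case using ex_normal_Ser[OF ab(1,3)] e sp_equiv_trans by blast
next
  case (Par l r)
  then obtain a b where ab: "normal a" "sp_equiv l a" "normal b" "sp_equiv r b" by auto
  have e: "sp_equiv (Par l r) (Par a b)" using ab Par.prems by (intro sp_equiv_cong) auto
  then have d: "distinct_leaves (Par a b)" by (simp add: sp_equiv_def)
  have "\<not> has_parallel_leaf a \<or> \<not> has_parallel_leaf b"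
    using Par.prems ab sp_equiv_has_parallel_leaf by auto
  then show ?case
  proof
    assume "\<not> has_parallel_leaf b"
    then show ?thesis using ex_normal_Par'[OF ab(1,3) d] e sp_equiv_trans by blast
  next
    assume h: "\<not> has_parallel_leaf a"
    have c: "sp_equiv (Par a b) (Par b a)" by (rule sp_equiv_commute(2)[OF d])
    then have "distinct_leaves (Par b a)" by (simp add: sp_equiv_def)
    then show ?thesis using ex_normal_Par'[OF ab(3,1) _ h] e c sp_equiv_trans by blast
  qed
qed

lemma simple_tree_normal: "normal T \<Longrightarrow> simple_tree T"
  by (induction T) auto

section \<open>Counting trees in normal form\<close>

text \<open>Twice the rank minus the number of leaves.\<close>

fun defect :: "'a sptree \<Rightarrow> int" where
  "defect (Leaf a) = 1"
| "defect (Ser l r) = defect l + defect r"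
| "defect (Par l r) = defect l + defect r - 2"

lemma defect_eq:
  "distinct_leaves T \<Longrightarrow> defect T = 2 * int (tree_rank T) - int (card (leaves T))"
proof (induction T)
  case (Par l r)
  then show ?case using tree_rank_pos[of l] by (auto simp: card_Un_disjoint of_nat_diff)
qed (auto simp: card_Un_disjoint)

text \<open>At a parallel node the right child has no parallel leaf, so its defect of at least 2
  cancels the -2 and the bound for the left child survives. A series node adds two values of at
  least 1.\<close>

lemma defect_ge:
  assumes "normal T"
  shows "defect T \<ge> 1" "\<not> has_parallel_leaf T \<Longrightarrow> defect T \<ge> 2"
proof -
  have "defect T \<ge> 1 \<and> (\<not> has_parallel_leaf T \<longrightarrow> defect T \<ge> 2)"
    using assms
  proof (induction T)
    case (Par l r)
    have "\<not> has_parallel_leaf l" if "is_Ser l" using that by (cases l) auto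
    moreover have "has_parallel_leaf l" if "is_Leaf l" using that by (cases l) auto
    ultimately show ?case using Par by auto
  qed auto
  then show "defect T \<ge> 1" "\<not> has_parallel_leaf T \<Longrightarrow> defect T \<ge> 2" by auto
qed

section \<open>Labelled trees and increasing relabellings\<close>

definition trees_on :: "('a::linorder sptree \<Rightarrow> bool) \<Rightarrow> 'a set \<Rightarrow> 'a sptree set" where
  "trees_on P A = {T. P T \<and> normal T \<and> distinct_leaves T \<and> leaves T = A}"

text \<open>Membership depends on the shape alone, so arbitrary maps are allowed. The
  label-dependent condition \<open>normal\<close> is handled separately, for increasing maps, by
  \<open>normal_map\<close>.\<close>

definition relabel_invariant :: "('a sptree \<Rightarrow> bool) \<Rightarrow> bool" where
  "relabel_invariant P \<longleftrightarrow> (\<forall>h T. P (map_sptree h T) = P T)"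

lemma leaves_map [simp]: "leaves (map_sptree h T) = h ` leaves T"
  by (induction T) auto

lemma is_Leaf_map [simp]: "is_Leaf (map_sptree h T) = is_Leaf T"
  and is_Ser_map [simp]: "is_Ser (map_sptree h T) = is_Ser T"
  by (cases T; simp)+

lemma has_parallel_leaf_map [simp]: "has_parallel_leaf (map_sptree h T) = has_parallel_leaf T"
  by (induction T) auto

lemma defect_map [simp]: "defect (map_sptree h T) = defect T"
  by (induction T) auto

lemma distinct_leaves_map:
  assumes "inj_on h (leaves T)" "distinct_leaves T"
  shows "distinct_leaves (map_sptree h T)"
  using assms
proof (induction T)
  case (Ser l r)
  then have "h ` leaves l \<inter> h ` leaves r = {}"
    by (subst inj_on_image_Int[symmetric, where C = "leaves l \<union> leaves r"]) auto
  then show ?case using Ser by (simp add: inj_on_Un)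
next
  case (Par l r)
  then have "h ` leaves l \<inter> h ` leaves r = {}"
    by (subst inj_on_image_Int[symmetric, where C = "leaves l \<union> leaves r"]) auto
  then show ?case using Par by (simp add: inj_on_Un)
qed simp

lemma Min_image_strict_mono_on:
  fixes h :: "'a::linorder \<Rightarrow> 'b::linorder"
  assumes "strict_mono_on A h" "finite A" "A \<noteq> {}"
  shows "Min (h ` A) = h (Min A)"
  using assms by (intro Min_eqI) (auto intro!: strict_mono_on_leD[OF assms(1)] Min_in)

lemma normal_map:
  fixes h :: "'a::linorder \<Rightarrow> 'b::linorder"
  assumes "strict_mono_on (leaves T) h" "normal T"
  shows "normal (map_sptree h T)"
  using assms
proof (induction T)
  case (Ser l r)
  have "Min (h ` (leaves l \<union> leaves r)) = h (Min (leaves l \<union> leaves r))"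
    using Ser.prems(1) by (intro Min_image_strict_mono_on) auto
  moreover have "strict_mono_on (leaves l) h" "strict_mono_on (leaves r) h"
    using Ser.prems(1) by (auto simp: strict_mono_on_def)
  ultimately show ?case using Ser by (simp add: image_Un)
next
  case (Par l r)
  have "Min (h ` (leaves l \<union> leaves r)) = h (Min (leaves l \<union> leaves r))"
    using Par.prems(1) by (intro Min_image_strict_mono_on) auto
  moreover have "strict_mono_on (leaves l) h" "strict_mono_on (leaves r) h"
    using Par.prems(1) by (auto simp: strict_mono_on_def)
  ultimately show ?case using Par by (auto simp: image_Un)
qed auto

lemma map_sptree_inj:
  assumes "inj_on h A" "leaves T \<subseteq> A" "leaves U \<subseteq> A" "map_sptree h T = map_sptree h U"
  shows "T = U"
  using assms
proof (induction T arbitrary: U)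
  case (Leaf a)
  then show ?case by (cases U) (auto dest: inj_onD)
next
  case (Ser l r)
  then show ?case by (cases U) auto
next
  case (Par l r)
  then show ?case by (cases U) auto
qed

lemma finite_distinct_trees:
  assumes "finite A"
  shows "finite {T. distinct_leaves T \<and> leaves T = A}"
  using assms
proof (induction A rule: finite_psubset_induct)
  case (psubset A)
  let ?F = "\<lambda>B. {T. distinct_leaves T \<and> leaves T = B}"
  define G where "G = (\<Union>B\<in>{B. B \<subset> A}. ?F B)"
  have sub: "?F A \<subseteq> Leaf ` A \<union> case_prod Ser ` (G \<times> G) \<union> case_prod Par ` (G \<times> G)"
  proof
    fix T assume T: "T \<in> ?F A"
    have part: "l \<in> G \<and> r \<in> G"
      if "distinct_leaves l" "distinct_leaves r" "leaves l \<inter> leaves r = {}" "leaves l \<union> leaves r = A" for l r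
    proof -
      have "leaves l \<subset> A" "leaves r \<subset> A" using that leaves_nonempty[of l] leaves_nonempty[of r] by blast+
      then show ?thesis unfolding G_def using that by blast
    qed
    show "T \<in> Leaf ` A \<union> case_prod Ser ` (G \<times> G) \<union> case_prod Par ` (G \<times> G)"
    proof (cases T)
      case (Leaf a)
      then have "T \<in> Leaf ` A" using T by auto
      then show ?thesis by blast
    next
      case (Ser l r)
      then have "(l, r) \<in> G \<times> G" using part[of l r] T by simp
      then show ?thesis unfolding Ser by force
    next
      case (Par l r)
      then have "(l, r) \<in> G \<times> G" using part[of l r] T by simp
      then show ?thesis unfolding Par by force
    qed
  qed
  have "finite {B. B \<subset> A}" by (rule finite_subset[of _ "Pow A"]) (use psubset.hyps in auto)
  then have "finite G" unfolding G_def using psubset.IH by blast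
  then show ?case using psubset.hyps by (intro finite_subset[OF sub]) simp
qed

lemma finite_trees_on: "finite A \<Longrightarrow> finite (trees_on P A)"
  by (rule finite_subset[OF _ finite_distinct_trees]) (auto simp: trees_on_def)

lemma trees_on_empty [simp]: "trees_on P {} = {}"
  by (simp add: trees_on_def)

text \<open>One inequality is enough, since it can be applied to an order isomorphism and to its
  inverse.\<close>

lemma card_trees_on_le:
  fixes h :: "'a::linorder \<Rightarrow> 'a"
  assumes h: "strict_mono_on A h" and P: "relabel_invariant P" and A: "finite A"
  shows "card (trees_on P A) \<le> card (trees_on P (h ` A))"
proof (rule card_inj_on_le)
  have inj: "inj_on h A" using h by (rule strict_mono_on_imp_inj_on)
  then show "inj_on (map_sptree h) (trees_on P A)"
    by (auto intro!: inj_onI dest: map_sptree_inj simp: trees_on_def)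
  show "map_sptree h ` trees_on P A \<subseteq> trees_on P (h ` A)"
    using h P inj by (auto simp: trees_on_def normal_map distinct_leaves_map relabel_invariant_def)
  show "finite (trees_on P (h ` A))" using A by (simp add: finite_trees_on)
qed

definition num_trees :: "(nat sptree \<Rightarrow> bool) \<Rightarrow> nat \<Rightarrow> nat" where
  "num_trees P m = card (trees_on P {..<m})"

lemma num_trees_0 [simp]: "num_trees P 0 = 0"
  by (simp add: num_trees_def)

lemma card_trees_on:
  fixes A :: "nat set"
  assumes "finite A" "relabel_invariant P"
  shows "card (trees_on P A) = num_trees P (card A)"
proof (rule antisym)
  obtain h where h: "bij_betw h {..<card A} A" "strict_mono_on {..<card A} h"
    using ex_bij_betw_strict_mono_card[OF assms(1)] .
  let ?n = "card A"
  have hA: "h ` {..<?n} = A" and sm: "strict_mono_on {..<?n} h"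
    using h by (auto simp: bij_betw_def)
  show "num_trees P ?n \<le> card (trees_on P A)"
    using card_trees_on_le[OF sm assms(2)] by (simp add: num_trees_def hA)
  let ?g = "inv_into {..<?n} h"
  have inj: "inj_on h {..<?n}" using sm by (rule strict_mono_on_imp_inj_on)
  have "strict_mono_on A ?g"
  proof (rule strict_mono_onI)
    fix x y assume xy: "x \<in> A" "y \<in> A" "x < y"
    then have "?g x \<in> {..<?n}" "?g y \<in> {..<?n}" "h (?g x) = x" "h (?g y) = y"
      using hA inv_into_into[of _ h "{..<?n}"] f_inv_into_f[of _ h "{..<?n}"] by blast+
    then show "?g x < ?g y" using xy(3) sm strict_mono_on_less by metis
  qed
  moreover have "?g ` A = {..<?n}" using inj hA by (metis inv_into_image_cancel subset_refl)
  ultimately show "card (trees_on P A) \<le> num_trees P ?n"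
    using card_trees_on_le[of A ?g P] assms by (simp add: num_trees_def)
qed

lemma sum_Pow_card:
  assumes "finite A"
  shows "(\<Sum>B\<in>Pow A. f (card B)) = (\<Sum>j\<le>card A. of_nat (card A choose j) * (f j :: 'b::comm_semiring_1))"
proof -
  have "(\<Sum>B\<in>Pow A. f (card B)) = (\<Sum>j\<le>card A. \<Sum>B\<in>{B \<in> Pow A. card B = j}. f (card B))"
    using assms by (intro sum.group[symmetric]) (auto intro: card_mono)
  also have "\<dots> = (\<Sum>j\<le>card A. of_nat (card A choose j) * f j)"
    using assms by (intro sum.cong refl) (simp add: n_subsets)
  finally show ?thesis .
qed

definition ser_of :: "('a sptree \<Rightarrow> bool) \<Rightarrow> ('a sptree \<Rightarrow> bool) \<Rightarrow> 'a sptree \<Rightarrow> bool" where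
  "ser_of P R T \<longleftrightarrow> (\<exists>l r. T = Ser l r \<and> P l \<and> R r)"

definition par_of :: "('a sptree \<Rightarrow> bool) \<Rightarrow> ('a sptree \<Rightarrow> bool) \<Rightarrow> 'a sptree \<Rightarrow> bool" where
  "par_of P R T \<longleftrightarrow> (\<exists>l r. T = Par l r \<and> P l \<and> R r)"

text \<open>The smallest label 0 is forced into the left child, so only the other \<open>j\<close>
  labels of that child are chosen, among \<open>k\<close>. The parameter \<open>op\<close> stands
  for either constructor.\<close>

lemma card_split_trees:
  fixes op :: "nat sptree \<Rightarrow> nat sptree \<Rightarrow> nat sptree"
  assumes inj: "\<And>l r l' r'. op l r = op l' r' \<Longrightarrow> l = l' \<and> r = r'"
    and P: "relabel_invariant P" and R: "relabel_invariant R"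
    and S: "S = {op l r | l r. leaves l \<union> leaves r = {..<Suc k} \<and> leaves l \<inter> leaves r = {} \<and>
      0 \<in> leaves l \<and> l \<in> trees_on P (leaves l) \<and> r \<in> trees_on R (leaves r)}"
  shows "card S = (\<Sum>j\<le>k. (k choose j) * (num_trees P (Suc j) * num_trees R (k - j)))"
proof -
  let ?N = "{1..<Suc k}"
  \<comment> \<open>Here \<open>B\<close> collects the nonzero labels of the left child.\<close>
  let ?G = "\<lambda>B. case_prod op ` (trees_on P (insert 0 B) \<times> trees_on R (?N - B))"
  have "S = (\<Union>B\<in>Pow ?N. ?G B)"
  proof (intro subset_antisym subsetI)
    fix T assume "T \<in> S"
    then obtain l r where T: "T = op l r" "leaves l \<union> leaves r = {..<Suc k}" "leaves l \<inter> leaves r = {}"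
      "0 \<in> leaves l" "l \<in> trees_on P (leaves l)" "r \<in> trees_on R (leaves r)" unfolding S by blast
    have "leaves l - {0} \<subseteq> ?N" using T(2) by (auto simp: subset_iff)
    moreover have "insert 0 (leaves l - {0}) = leaves l" using T(4) by blast
    moreover have "?N = {..<Suc k} - {0}" by auto
    then have "?N - (leaves l - {0}) = leaves r" unfolding T(2)[symmetric] using T(3,4) by blast
    ultimately show "T \<in> (\<Union>B\<in>Pow ?N. ?G B)"
      using T(1,5,6) by (intro UN_I[of "leaves l - {0}"]) auto
  next
    fix T assume "T \<in> (\<Union>B\<in>Pow ?N. ?G B)"
    then obtain B l r where B: "B \<subseteq> ?N" "T = op l r" "l \<in> trees_on P (insert 0 B)" "r \<in> trees_on R (?N - B)" by auto
    have lv: "leaves l = insert 0 B" "leaves r = ?N - B" using B by (auto simp: trees_on_def)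
    have "leaves l \<union> leaves r = {..<Suc k}" "leaves l \<inter> leaves r = {}" using B(1) unfolding lv by auto
    moreover have "l \<in> trees_on P (leaves l)" "r \<in> trees_on R (leaves r)" "0 \<in> leaves l" using B lv by simp_all
    ultimately show "T \<in> S" unfolding S B(2) by blast
  qed
  also have "card \<dots> = (\<Sum>B\<in>Pow ?N. card (?G B))"
  proof (rule card_UN_disjoint)
    show "finite (Pow ?N)" by simp
    show "\<forall>B\<in>Pow ?N. finite (?G B)"
    proof
      fix B assume "B \<in> Pow ?N"
      then have "finite B" by (meson PowD finite_atLeastLessThan finite_subset)
      then show "finite (?G B)" by (intro finite_imageI finite_cartesian_product finite_trees_on) simp_all
    qed
    show "\<forall>B\<in>Pow ?N. \<forall>C\<in>Pow ?N. B \<noteq> C \<longrightarrow> ?G B \<inter> ?G C = {}"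
    proof (intro ballI impI)
      fix B C assume BC: "B \<in> Pow ?N" "C \<in> Pow ?N" "B \<noteq> C"
      show "?G B \<inter> ?G C = {}"
      proof (rule ccontr)
        assume "?G B \<inter> ?G C \<noteq> {}"
        then obtain T where T: "T \<in> ?G B" "T \<in> ?G C" by blast
        obtain l r where "T = op l r" "l \<in> trees_on P (insert 0 B)" using T(1) by auto
        moreover obtain l' r' where "T = op l' r'" "l' \<in> trees_on P (insert 0 C)" using T(2) by auto
        ultimately have "insert 0 B = insert 0 C" using inj[of l r l' r'] by (auto simp: trees_on_def)
        moreover have "0 \<notin> B" "0 \<notin> C" using BC by auto
        ultimately show False using BC(3) by (simp add: insert_ident)
      qed
    qed
  qed
  also have "\<dots> = (\<Sum>B\<in>Pow ?N. num_trees P (Suc (card B)) * num_trees R (k - card B))"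
  proof (intro sum.cong refl)
    fix B assume B: "B \<in> Pow ?N"
    then have fB: "finite B" by (meson PowD finite_atLeastLessThan finite_subset)
    have fB: "finite B" "0 \<notin> B" using fB B by auto
    have "inj_on (case_prod op) (trees_on P (insert 0 B) \<times> trees_on R (?N - B))"
    proof (rule inj_onI)
      fix x y assume "case_prod op x = case_prod op y"
      then show "x = y" using inj[of "fst x" "snd x" "fst y" "snd y"] by (simp add: case_prod_beta prod_eq_iff)
    qed
    then have "card (?G B) = card (trees_on P (insert 0 B)) * card (trees_on R (?N - B))"
      unfolding card_cartesian_product[symmetric] by (rule card_image)
    also have "\<dots> = num_trees P (card (insert 0 B)) * num_trees R (card (?N - B))"
      using fB P R by (simp add: card_trees_on)
    also have "card (insert 0 B) = Suc (card B)" using fB by simp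
    also have "card (?N - B) = k - card B" using B fB by (subst card_Diff_subset) auto
    finally show "card (?G B) = num_trees P (Suc (card B)) * num_trees R (k - card B)" .
  qed
  also have "\<dots> = (\<Sum>j\<le>k. (k choose j) * (num_trees P (Suc j) * num_trees R (k - j)))"
    using sum_Pow_card[of ?N "\<lambda>j. num_trees P (Suc j) * num_trees R (k - j)"] by simp
  finally show ?thesis .
qed

lemma Min_lessThan_Suc [simp]: "Min {..<Suc k} = (0::nat)"
  by (intro Min_eqI) auto

text \<open>The hypothesis \<open>ns\<close> is the restriction of \<open>normal\<close> on left
  children of series nodes. The right child may again be a series node, as the comb continues
  there.\<close>

lemma num_trees_ser_of:
  assumes P: "relabel_invariant P" and R: "relabel_invariant R" and ns: "\<And>T. P T \<Longrightarrow> \<not> is_Ser T"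
  shows "num_trees (ser_of P R) (Suc k) = (\<Sum>j\<le>k. (k choose j) * (num_trees P (Suc j) * num_trees R (k - j)))"
  unfolding num_trees_def[of "ser_of P R"]
proof (rule card_split_trees[OF _ P R])
  show "trees_on (ser_of P R) {..<Suc k} = {Ser l r | l r. leaves l \<union> leaves r = {..<Suc k} \<and> leaves l \<inter> leaves r = {} \<and>
      0 \<in> leaves l \<and> l \<in> trees_on P (leaves l) \<and> r \<in> trees_on R (leaves r)}" (is "?L = ?R")
  proof (intro subset_antisym subsetI)
    fix T assume "T \<in> ?L"
    then obtain l r where T: "T = Ser l r" "P l" "R r" "normal (Ser l r)" "distinct_leaves (Ser l r)" "leaves l \<union> leaves r = {..<Suc k}"
      by (auto simp: trees_on_def ser_of_def)
    have "0 \<in> leaves l" using T(4) by (simp add: T(6))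
    then show "T \<in> ?R" using T by (auto simp: trees_on_def)
  next
    fix T assume "T \<in> ?R"
    then obtain l r where T: "T = Ser l r" "leaves l \<union> leaves r = {..<Suc k}" "leaves l \<inter> leaves r = {}"
      "0 \<in> leaves l" "P l" "normal l" "distinct_leaves l" "R r" "normal r" "distinct_leaves r"
      by (auto simp: trees_on_def)
    have "normal (Ser l r)" using T(4,6,9) ns[OF T(5)] by (simp add: T(2))
    then show "T \<in> ?L" using T(1-3,5,7,8,10) by (simp add: trees_on_def ser_of_def)
  qed
qed simp

lemma num_trees_par_of:
  assumes P: "relabel_invariant P" and R: "relabel_invariant R" and s: "\<And>T. P T \<Longrightarrow> is_Ser T"
    and h: "\<And>T. R T \<Longrightarrow> \<not> has_parallel_leaf T"
  shows "num_trees (par_of P R) (Suc k) = (\<Sum>j\<le>k. (k choose j) * (num_trees P (Suc j) * num_trees R (k - j)))"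
  unfolding num_trees_def[of "par_of P R"]
proof (rule card_split_trees[OF _ P R])
  show "trees_on (par_of P R) {..<Suc k} = {Par l r | l r. leaves l \<union> leaves r = {..<Suc k} \<and> leaves l \<inter> leaves r = {} \<and>
      0 \<in> leaves l \<and> l \<in> trees_on P (leaves l) \<and> r \<in> trees_on R (leaves r)}" (is "?L = ?R")
  proof (intro subset_antisym subsetI)
    fix T assume "T \<in> ?L"
    then obtain l r where T: "T = Par l r" "P l" "R r" "normal (Par l r)" "distinct_leaves (Par l r)" "leaves l \<union> leaves r = {..<Suc k}"
      by (auto simp: trees_on_def par_of_def)
    have "\<not> is_Leaf l" using s[OF T(2)] by (cases l) auto
    then have "0 \<in> leaves l" using T(4) by (simp add: T(6))
    then show "T \<in> ?R" using T by (auto simp: trees_on_def)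
  next
    fix T assume "T \<in> ?R"
    then obtain l r where T: "T = Par l r" "leaves l \<union> leaves r = {..<Suc k}" "leaves l \<inter> leaves r = {}"
      "0 \<in> leaves l" "P l" "normal l" "distinct_leaves l" "R r" "normal r" "distinct_leaves r"
      by (auto simp: trees_on_def)
    have "normal (Par l r)" using T(4,6,9) s[OF T(5)] h[OF T(8)] by (simp add: T(2))
    then show "T \<in> ?L" using T(1-3,5,7,8,10) by (simp add: trees_on_def par_of_def)
  qed
qed simp

text \<open>The parallel leaf comes first whatever its label, so there are \<open>Suc k\<close>
  choices instead of a split by the position of 0.\<close>

lemma num_trees_par_of_Leaf:
  assumes R: "relabel_invariant R" and h: "\<And>T. R T \<Longrightarrow> \<not> has_parallel_leaf T"
  shows "num_trees (par_of is_Leaf R) (Suc k) = Suc k * num_trees R k"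
proof -
  let ?N = "{..<Suc k}"
  have "trees_on (par_of is_Leaf R) ?N = (\<Union>a\<in>?N. Par (Leaf a) ` trees_on R (?N - {a}))"
  proof (intro subset_antisym subsetI)
    fix T assume "T \<in> trees_on (par_of is_Leaf R) ?N"
    then obtain a r where T: "T = Par (Leaf a) r" "R r" "normal r" "distinct_leaves r" "a \<notin> leaves r" "insert a (leaves r) = ?N"
      by (auto simp: trees_on_def par_of_def is_Leaf_def)
    have "leaves r = ?N - {a}" "a \<in> ?N" using T(5,6) by blast+
    then show "T \<in> (\<Union>a\<in>?N. Par (Leaf a) ` trees_on R (?N - {a}))"
      using T(1-4) by (intro UN_I[of a]) (simp_all add: trees_on_def)
  next
    fix T assume "T \<in> (\<Union>a\<in>?N. Par (Leaf a) ` trees_on R (?N - {a}))"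
    then obtain a r where T: "T = Par (Leaf a) r" "a \<in> ?N" "R r" "normal r" "distinct_leaves r" "leaves r = ?N - {a}"
      by (auto simp: trees_on_def)
    have "leaves T = ?N" using T(2) unfolding T(1) by (auto simp: T(6))
    then show "T \<in> trees_on (par_of is_Leaf R) ?N"
      using T(1,3-6) h[OF T(3)] by (simp add: trees_on_def par_of_def)
  qed
  then have "num_trees (par_of is_Leaf R) (Suc k) = card (\<Union>a\<in>?N. Par (Leaf a) ` trees_on R (?N - {a}))"
    by (simp only: num_trees_def)
  also have "\<dots> = (\<Sum>a\<in>?N. card (Par (Leaf a) ` trees_on R (?N - {a})))"
    by (intro card_UN_disjoint ballI finite_imageI finite_trees_on) auto
  also have "\<dots> = (\<Sum>a\<in>?N. num_trees R k)"
  proof (intro sum.cong refl)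
    fix a assume a: "a \<in> ?N"
    have "card (Par (Leaf a) ` trees_on R (?N - {a})) = card (trees_on R (?N - {a}))"
      by (intro card_image inj_onI) simp
    also have "\<dots> = num_trees R k" using a R by (simp add: card_trees_on)
    finally show "card (Par (Leaf a) ` trees_on R (?N - {a})) = num_trees R k" .
  qed
  also have "\<dots> = Suc k * num_trees R k" by simp
  finally show ?thesis .
qed

lemma num_trees_is_Leaf: "num_trees is_Leaf m = (if m = 1 then 1 else 0)"
proof -
  have "trees_on is_Leaf {..<m} = (if m = 1 then {Leaf 0} else {})"
  proof -
    have "{a} = {..<m} \<longleftrightarrow> m = 1 \<and> a = 0" for a
    proof
      assume *: "{a} = {..<m}"
      then have "card {a} = card {..<m}" by simp
      then have "m = 1" by simp
      then show "m = 1 \<and> a = 0" using * by auto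
    qed auto
    moreover have "T \<in> trees_on is_Leaf {..<m} \<longleftrightarrow> (\<exists>a. T = Leaf a \<and> {a} = {..<m})" for T
      by (cases T) (simp_all add: trees_on_def)
    ultimately show ?thesis by (intro set_eqI) simp
  qed
  then show ?thesis by (simp add: num_trees_def)
qed

lemma num_trees_cong: "(\<And>T. normal T \<Longrightarrow> P T = R T) \<Longrightarrow> num_trees P m = num_trees R m"
  unfolding num_trees_def trees_on_def by (intro arg_cong[where f = card]) blast

lemma num_trees_disj:
  assumes "\<And>T. \<not> (P T \<and> R T)"
  shows "num_trees (\<lambda>T. P T \<or> R T) m = num_trees P m + num_trees R m"
proof -
  have "trees_on (\<lambda>T. P T \<or> R T) {..<m} = trees_on P {..<m} \<union> trees_on R {..<m}"
    by (auto simp: trees_on_def)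
  moreover have "trees_on P {..<m} \<inter> trees_on R {..<m} = {}" using assms by (auto simp: trees_on_def)
  ultimately show ?thesis unfolding num_trees_def by (simp add: card_Un_disjoint finite_trees_on)
qed

section \<open>Exponential generating functions of tree classes\<close>

definition egf :: "(nat sptree \<Rightarrow> bool) \<Rightarrow> rat fps" where
  "egf P = Abs_fps (\<lambda>m. of_nat (num_trees P m) / fact m)"

lemma egf_nth_0 [simp]: "egf P $ 0 = 0"
  by (simp add: egf_def)

lemma egf_cong: "(\<And>T. normal T \<Longrightarrow> P T = R T) \<Longrightarrow> egf P = egf R"
  using num_trees_cong unfolding egf_def by metis

lemma egf_disj: "(\<And>T. \<not> (P T \<and> R T)) \<Longrightarrow> egf (\<lambda>T. P T \<or> R T) = egf P + egf R"
  by (intro fps_ext) (simp add: egf_def num_trees_disj add_divide_distrib)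

lemma egf_is_Leaf: "egf is_Leaf = fps_X"
  by (intro fps_ext) (simp add: egf_def num_trees_is_Leaf fps_X_def)

lemma egf_par_of_Leaf:
  assumes "relabel_invariant R" "\<And>T. R T \<Longrightarrow> \<not> has_parallel_leaf T"
  shows "egf (par_of is_Leaf R) = fps_X * egf R"
proof (rule fps_ext)
  fix m show "egf (par_of is_Leaf R) $ m = (fps_X * egf R) $ m"
  proof (cases m)
    case (Suc k)
    have "egf (par_of is_Leaf R) $ Suc k = of_nat (Suc k * num_trees R k) / fact (Suc k)"
      by (simp only: egf_def fps_nth_Abs_fps num_trees_par_of_Leaf[OF assms])
    also have "\<dots> = of_nat (num_trees R k) / fact k"
      by (simp only: of_nat_mult fact_Suc) (simp del: of_nat_Suc)
    finally show ?thesis using Suc by (simp add: egf_def)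
  qed simp
qed

text \<open>The boxed product of labelled classes: differentiation removes the smallest label, which
  by convention belongs to the left factor.\<close>

lemma deriv_egf_product:
  assumes "\<And>k. num_trees C (Suc k) = (\<Sum>j\<le>k. (k choose j) * (num_trees P (Suc j) * num_trees R (k - j)))"
  shows "fps_deriv (egf C) = fps_deriv (egf P) * egf R"
proof (rule fps_ext)
  fix k
  have "(fps_deriv (egf P) * egf R) $ k = (\<Sum>j\<le>k. fps_deriv (egf P) $ j * egf R $ (k - j))"
    by (simp add: fps_mult_nth atLeast0AtMost)
  also have "\<dots> = (\<Sum>j\<le>k. of_nat ((k choose j) * (num_trees P (Suc j) * num_trees R (k - j))) / fact k)"
  proof (intro sum.cong refl)
    fix j assume "j \<in> {..k}"
    then have "of_nat (k choose j) = (fact k / (fact j * fact (k - j)) :: rat)"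
      by (simp add: binomial_fact)
    then show "fps_deriv (egf P) $ j * egf R $ (k - j) = of_nat ((k choose j) * (num_trees P (Suc j) * num_trees R (k - j))) / fact k"
      by (simp add: egf_def divide_simps)
  qed
  also have "\<dots> = of_nat (num_trees C (Suc k)) / fact k"
    by (simp add: assms sum_divide_distrib)
  also have "\<dots> = fps_deriv (egf C) $ k"
    by (simp add: egf_def divide_simps)
  finally show "fps_deriv (egf C) $ k = (fps_deriv (egf P) * egf R) $ k" by simp
qed

text \<open>Leafless means without a leaf joining the terminals directly. These are the possible
  right children of parallel nodes; series trees and single leaves are the possible left children
  there, and nonseries trees those of series nodes.\<close>

definition leafless_trees :: "int \<Rightarrow> nat sptree \<Rightarrow> bool" where
  "leafless_trees d T \<longleftrightarrow> \<not> has_parallel_leaf T \<and> defect T = d"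

definition series_trees :: "int \<Rightarrow> nat sptree \<Rightarrow> bool" where
  "series_trees d T \<longleftrightarrow> is_Ser T \<and> defect T = d"

definition nonseries_trees :: "int \<Rightarrow> nat sptree \<Rightarrow> bool" where
  "nonseries_trees d T \<longleftrightarrow> \<not> is_Ser T \<and> defect T = d"

lemma relabel_invariant_classes [simp]:
  "relabel_invariant (leafless_trees d)" "relabel_invariant (series_trees d)" "relabel_invariant (nonseries_trees d)"
  by (simp_all add: relabel_invariant_def leafless_trees_def series_trees_def nonseries_trees_def)

lemma ser_of_simps [simp]:
  "\<not> ser_of P R (Leaf a)" "ser_of P R (Ser l r) = (P l \<and> R r)" "\<not> ser_of P R (Par l r)"
  by (auto simp: ser_of_def)

lemma par_of_simps [simp]:
  "\<not> par_of P R (Leaf a)" "\<not> par_of P R (Ser l r)" "par_of P R (Par l r) = (P l \<and> R r)"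
  by (auto simp: par_of_def)

text \<open>Here and in \<open>normal_ParD\<close> the lower bounds are listed by root type of the
  children, so that linear arithmetic reduces a given small defect to a few splits.\<close>

lemma normal_SerD:
  assumes "normal (Ser l r)"
  shows "\<not> is_Ser l \<and> defect l \<ge> 1 \<and> (is_Ser r \<and> defect r \<ge> 2 \<or> \<not> is_Ser r \<and> defect r \<ge> 1)"
proof -
  have "defect r \<ge> 2" if "is_Ser r" using that assms defect_ge(2)[of r] by (cases r) simp_all
  then show ?thesis using assms defect_ge(1)[of l] defect_ge(1)[of r] by auto
qed

lemma normal_ParD:
  assumes "normal (Par l r)"
  shows "\<not> has_parallel_leaf r \<and> defect r \<ge> 2 \<and>
    (is_Leaf l \<and> \<not> is_Ser l \<and> has_parallel_leaf l \<and> defect l = 1 \<or>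
     is_Ser l \<and> \<not> is_Leaf l \<and> \<not> has_parallel_leaf l \<and> defect l \<ge> 2)"
proof (cases l)
  case (Leaf a)
  then show ?thesis using assms defect_ge(2)[of r] by simp
next
  case (Ser l1 l2)
  then have "defect l \<ge> 2" using assms defect_ge(2)[of l] by simp
  then show ?thesis using assms defect_ge(2)[of r] unfolding Ser by simp
next
  case (Par l1 l2)
  then show ?thesis using assms by simp
qed

lemma deriv_egf_ser_of:
  "fps_deriv (egf (ser_of (nonseries_trees d) (nonseries_trees e))) = fps_deriv (egf (nonseries_trees d)) * egf (nonseries_trees e)"
  "fps_deriv (egf (ser_of (nonseries_trees d) (series_trees e))) = fps_deriv (egf (nonseries_trees d)) * egf (series_trees e)"
  by (intro deriv_egf_product num_trees_ser_of; simp add: nonseries_trees_def)+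

lemma deriv_egf_par_of:
  "fps_deriv (egf (par_of (series_trees d) (leafless_trees e))) = fps_deriv (egf (series_trees d)) * egf (leafless_trees e)"
  by (intro deriv_egf_product num_trees_par_of; simp add: series_trees_def leafless_trees_def)

text \<open>Defect 1 below a parallel root comes only from 1 + 2 - 2 with a leaf on the left; a
  series left child already gives at least 2.\<close>

lemma egf_nonseries_1: "egf (nonseries_trees 1) = fps_X + fps_X * egf (leafless_trees 2)"
proof -
  have "egf (nonseries_trees 1) = egf (\<lambda>T. is_Leaf T \<or> par_of is_Leaf (leafless_trees 2) T)"
  proof (rule egf_cong)
    fix T :: "nat sptree" assume "normal T"
    then show "nonseries_trees 1 T \<longleftrightarrow> is_Leaf T \<or> par_of is_Leaf (leafless_trees 2) T"
    proof (cases T)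
      case (Par l r)
      from normal_ParD[OF \<open>normal T\<close>[unfolded Par]] show ?thesis
        unfolding Par by (elim disjE conjE; simp add: nonseries_trees_def leafless_trees_def; auto?)
    qed (auto simp: nonseries_trees_def par_of_def)
  qed
  also have "\<dots> = egf is_Leaf + egf (par_of is_Leaf (leafless_trees 2))"
    by (rule egf_disj) (auto simp: par_of_def)
  also have "\<dots> = fps_X + fps_X * egf (leafless_trees 2)"
    by (subst egf_par_of_Leaf) (auto simp: egf_is_Leaf leafless_trees_def)
  finally show ?thesis .
qed

text \<open>The two splits are 1 + 3 - 2 with a leaf on the left and 2 + 2 - 2 with a series tree on
  the left.\<close>

lemma egf_nonseries_2: "egf (nonseries_trees 2) = fps_X * egf (leafless_trees 3) + egf (par_of (series_trees 2) (leafless_trees 2))"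
proof -
  have "egf (nonseries_trees 2) = egf (\<lambda>T. par_of is_Leaf (leafless_trees 3) T \<or> par_of (series_trees 2) (leafless_trees 2) T)"
  proof (rule egf_cong)
    fix T :: "nat sptree" assume "normal T"
    then show "nonseries_trees 2 T \<longleftrightarrow> par_of is_Leaf (leafless_trees 3) T \<or> par_of (series_trees 2) (leafless_trees 2) T"
    proof (cases T)
      case (Par l r)
      from normal_ParD[OF \<open>normal T\<close>[unfolded Par]] show ?thesis
        unfolding Par by (elim disjE conjE; simp add: nonseries_trees_def leafless_trees_def series_trees_def; auto?)
    qed (auto simp: nonseries_trees_def par_of_def)
  qed
  also have "\<dots> = egf (par_of is_Leaf (leafless_trees 3)) + egf (par_of (series_trees 2) (leafless_trees 2))"
    by (rule egf_disj) (auto simp: par_of_def series_trees_def is_Leaf_def)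
  also have "egf (par_of is_Leaf (leafless_trees 3)) = fps_X * egf (leafless_trees 3)"
    by (rule egf_par_of_Leaf) (auto simp: leafless_trees_def)
  finally show ?thesis .
qed

lemma egf_leafless_2: "egf (leafless_trees 2) = egf (series_trees 2) + egf (par_of (series_trees 2) (leafless_trees 2))"
proof -
  have "egf (leafless_trees 2) = egf (\<lambda>T. series_trees 2 T \<or> par_of (series_trees 2) (leafless_trees 2) T)"
  proof (rule egf_cong)
    fix T :: "nat sptree" assume "normal T"
    then show "leafless_trees 2 T \<longleftrightarrow> series_trees 2 T \<or> par_of (series_trees 2) (leafless_trees 2) T"
    proof (cases T)
      case (Par l r)
      from normal_ParD[OF \<open>normal T\<close>[unfolded Par]] show ?thesis
        unfolding Par by (elim disjE conjE; simp add: leafless_trees_def series_trees_def; auto?)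
    qed (auto simp: leafless_trees_def series_trees_def par_of_def)
  qed
  also have "\<dots> = egf (series_trees 2) + egf (par_of (series_trees 2) (leafless_trees 2))"
    by (rule egf_disj) (auto simp: par_of_def series_trees_def)
  finally show ?thesis .
qed

lemma egf_leafless_3: "egf (leafless_trees 3) = egf (series_trees 3) + (egf (par_of (series_trees 3) (leafless_trees 2)) + egf (par_of (series_trees 2) (leafless_trees 3)))"
proof -
  have "egf (leafless_trees 3) = egf (\<lambda>T. series_trees 3 T \<or> (par_of (series_trees 3) (leafless_trees 2) T \<or> par_of (series_trees 2) (leafless_trees 3) T))"
  proof (rule egf_cong)
    fix T :: "nat sptree" assume "normal T"
    then show "leafless_trees 3 T \<longleftrightarrow> series_trees 3 T \<or> (par_of (series_trees 3) (leafless_trees 2) T \<or> par_of (series_trees 2) (leafless_trees 3) T)"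
    proof (cases T)
      case (Par l r)
      from normal_ParD[OF \<open>normal T\<close>[unfolded Par]] show ?thesis
        unfolding Par by (elim disjE conjE; simp add: leafless_trees_def series_trees_def; auto?)
    qed (auto simp: leafless_trees_def series_trees_def par_of_def)
  qed
  also have "\<dots> = egf (series_trees 3) + egf (\<lambda>T. par_of (series_trees 3) (leafless_trees 2) T \<or> par_of (series_trees 2) (leafless_trees 3) T)"
    by (rule egf_disj) (auto simp: par_of_def series_trees_def)
  also have "egf (\<lambda>T. par_of (series_trees 3) (leafless_trees 2) T \<or> par_of (series_trees 2) (leafless_trees 3) T) = egf (par_of (series_trees 3) (leafless_trees 2)) + egf (par_of (series_trees 2) (leafless_trees 3))"
    by (rule egf_disj) (auto simp: par_of_def series_trees_def)
  finally show ?thesis .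
qed

lemma deriv_egf_series_2: "fps_deriv (egf (series_trees 2)) = fps_deriv (egf (nonseries_trees 1)) * egf (nonseries_trees 1)"
proof -
  have "egf (series_trees 2) = egf (ser_of (nonseries_trees 1) (nonseries_trees 1))"
  proof (rule egf_cong)
    fix T :: "nat sptree" assume "normal T"
    then show "series_trees 2 T \<longleftrightarrow> ser_of (nonseries_trees 1) (nonseries_trees 1) T"
    proof (cases T)
      case (Ser l r)
      from normal_SerD[OF \<open>normal T\<close>[unfolded Ser]] show ?thesis
        unfolding Ser by (elim disjE conjE; simp add: nonseries_trees_def series_trees_def; auto?)
    qed (auto simp: series_trees_def ser_of_def)
  qed
  then show ?thesis by (simp add: deriv_egf_ser_of)
qed

text \<open>The excess of one over the minimum sits in one of two nonseries children, or comes from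
  a series right child, whose minimum is 2 instead of 1.\<close>

lemma deriv_egf_series_3:
  "fps_deriv (egf (series_trees 3)) = fps_deriv (egf (nonseries_trees 1)) * egf (nonseries_trees 2) + (fps_deriv (egf (nonseries_trees 2)) * egf (nonseries_trees 1) +
     fps_deriv (egf (nonseries_trees 1)) * egf (series_trees 2))"
proof -
  have "egf (series_trees 3) = egf (\<lambda>T. ser_of (nonseries_trees 1) (nonseries_trees 2) T \<or> (ser_of (nonseries_trees 2) (nonseries_trees 1) T \<or> ser_of (nonseries_trees 1) (series_trees 2) T))"
  proof (rule egf_cong)
    fix T :: "nat sptree" assume "normal T"
    then show "series_trees 3 T \<longleftrightarrow> ser_of (nonseries_trees 1) (nonseries_trees 2) T \<or> (ser_of (nonseries_trees 2) (nonseries_trees 1) T \<or> ser_of (nonseries_trees 1) (series_trees 2) T)"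
    proof (cases T)
      case (Ser l r)
      from normal_SerD[OF \<open>normal T\<close>[unfolded Ser]] show ?thesis
        unfolding Ser by (elim disjE conjE; simp add: nonseries_trees_def series_trees_def; auto?)
    qed (auto simp: series_trees_def ser_of_def)
  qed
  also have "\<dots> = egf (ser_of (nonseries_trees 1) (nonseries_trees 2)) + egf (\<lambda>T. ser_of (nonseries_trees 2) (nonseries_trees 1) T \<or> ser_of (nonseries_trees 1) (series_trees 2) T)"
    by (rule egf_disj) (auto simp: ser_of_def nonseries_trees_def series_trees_def)
  also have "egf (\<lambda>T. ser_of (nonseries_trees 2) (nonseries_trees 1) T \<or> ser_of (nonseries_trees 1) (series_trees 2) T) = egf (ser_of (nonseries_trees 2) (nonseries_trees 1)) + egf (ser_of (nonseries_trees 1) (series_trees 2))"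
    by (rule egf_disj) (auto simp: ser_of_def nonseries_trees_def series_trees_def)
  finally show ?thesis by (simp add: deriv_egf_ser_of)
qed

section \<open>The cactus series\<close>

lemma sp_equiv_forests_Par:
  assumes "sp_equiv T U"
  shows "forests (Par T (Leaf e)) = forests (Par U (Leaf e))"
  using assms unfolding forests_def sp_equiv_def by simp

text \<open>The largest element is taken as root edge. Adding it in parallel leaves the rank
  \<open>n\<close> unchanged, so the tree on the other 2n - 3 elements has defect 2n - (2n - 3) = 3;
  it must lack a parallel leaf, which would form a pair with the root edge.\<close>

lemma simple_sp_matroids_eq_image:
  assumes "n > 1"
  shows "simple_sp_matroids {1..2 * n - 2} n =
    (\<lambda>T. forests (Par T (Leaf (2 * n - 2)))) ` trees_on (leafless_trees 3) {1..2 * n - 3}"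
proof -
  let ?e = "2 * n - 2" and ?A = "{1..2 * n - 3}" and ?E = "{1..2 * n - 2}"
  have e: "?e \<notin> ?A" "?e \<in> ?E" "?E - {?e} = ?A" "insert ?e ?A = ?E" "card ?E > 1" "card ?A = 2 * n - 3"
    using assms by auto
  note sp_iff = series_parallel_matroid_iff[OF e(5,2), unfolded e(3)]
  have tree: "distinct_leaves (Par T (Leaf ?e))" "leaves (Par T (Leaf ?e)) = ?E"
    "tree_rank (Par T (Leaf ?e)) = tree_rank T"
    "simple_tree (Par T (Leaf ?e)) \<longleftrightarrow> simple_tree T \<and> \<not> has_parallel_leaf T"
    if "distinct_leaves T" "leaves T = ?A" for T
    using that e(1,4) by auto
  have rank: "defect T = 3 \<longleftrightarrow> tree_rank T = n" if "distinct_leaves T" "leaves T = ?A" for T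
    using defect_eq[OF that(1)] that(2) e(6) assms by auto
  show ?thesis
  proof (intro subset_antisym subsetI)
    fix \<I> assume "\<I> \<in> simple_sp_matroids ?E n"
    then have I: "simple_matroid ?E \<I>" "series_parallel_matroid ?E \<I>" "matroid_rank \<I> = n"
      by (auto simp: simple_sp_matroids_def)
    obtain T where T: "distinct_leaves T" "leaves T = ?A" "\<I> = forests (Par T (Leaf ?e))"
      using I(2) sp_iff by blast
    have s: "simple_tree T" "\<not> has_parallel_leaf T"
      using I(1) simple_matroid_forests_iff[OF tree(1)[OF T(1,2)]] tree(2,4)[OF T(1,2)] T(3) by simp_all
    obtain U where U: "normal U" "sp_equiv T U" using ex_normal[OF T(1) s(1)] by blast
    have dU: "distinct_leaves U" "leaves U = ?A" using U(2) T(2) by (simp_all add: sp_equiv_def)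
    have IU: "\<I> = forests (Par U (Leaf ?e))" using sp_equiv_forests_Par[OF U(2)] T(3) by simp
    then have "tree_rank U = n"
      using I(3) matroid_rank_forests[OF tree(1)[OF dU]] tree(3)[OF dU] by simp
    moreover have "\<not> has_parallel_leaf U" using sp_equiv_has_parallel_leaf[OF U(2)] s(2) by simp
    ultimately have "U \<in> trees_on (leafless_trees 3) ?A" using U(1) dU rank[OF dU] by (simp add: trees_on_def leafless_trees_def)
    then show "\<I> \<in> (\<lambda>T. forests (Par T (Leaf ?e))) ` trees_on (leafless_trees 3) ?A" using IU by blast
  next
    fix \<I> assume "\<I> \<in> (\<lambda>T. forests (Par T (Leaf ?e))) ` trees_on (leafless_trees 3) ?A"
    then obtain T where I: "\<I> = forests (Par T (Leaf ?e))"
      and T: "\<not> has_parallel_leaf T" "defect T = 3" "normal T" "distinct_leaves T" "leaves T = ?A"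
      by (auto simp: trees_on_def leafless_trees_def)
    note t = tree[OF T(4,5)]
    have "matroid ?E \<I>" using matroid_forests[OF t(1)] t(2) I by simp
    moreover have "simple_matroid ?E \<I>"
      using simple_matroid_forests_iff[OF t(1)] t(2,4) I simple_tree_normal[OF T(3)] T(1) by simp
    moreover have "series_parallel_matroid ?E \<I>" using sp_iff T(4,5) I by blast
    moreover have "matroid_rank \<I> = n"
      using matroid_rank_forests[OF t(1)] t(3) I rank[OF T(4,5)] T(2) by simp
    ultimately show "\<I> \<in> simple_sp_matroids ?E n" by (simp add: simple_sp_matroids_def)
  qed
qed

lemma card_simple_sp_matroids:
  assumes "n > 1"
  shows "card (simple_sp_matroids {1..2 * n - 2} n) = num_trees (leafless_trees 3) (2 * n - 3)"
proof -
  have e: "2 * n - 2 \<notin> {1..2 * n - 3}" using assms by auto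
  have "inj_on (\<lambda>T. forests (Par T (Leaf (2 * n - 2)))) (trees_on (leafless_trees 3) {1..2 * n - 3})"
  proof (rule inj_onI)
    fix T U assume T: "T \<in> trees_on (leafless_trees 3) {1..2 * n - 3}" and U: "U \<in> trees_on (leafless_trees 3) {1..2 * n - 3}"
      and eq: "forests (Par T (Leaf (2 * n - 2))) = forests (Par U (Leaf (2 * n - 2)))"
    have "conn T = conn U"
      using forests_Par_Leaf_eqD[OF _ _ _ _ eq] T U e by (auto simp: trees_on_def)
    then show "T = U" using T U by (intro normal_eqI) (auto simp: trees_on_def)
  qed
  then show ?thesis
    unfolding simple_sp_matroids_eq_image[OF assms] by (simp only: card_image) (simp add: card_trees_on)
qed

section \<open>Differential equations for the two lowest layers\<close>

lemma fps_linear_ode_zero: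
  fixes D h :: "rat fps"
  assumes "fps_deriv D = h * D" "D $ 0 = 0"
  shows "D = 0"
proof (rule fps_ext)
  fix m show "D $ m = 0 $ m"
  proof (induction m rule: less_induct)
    case (less m)
    show ?case
    proof (cases m)
      case (Suc k)
      have "of_nat (Suc k) * D $ Suc k = (h * D) $ k" by (simp flip: assms(1))
      also have "\<dots> = (\<Sum>i=0..k. h $ i * D $ (k - i))" by (simp add: fps_mult_nth)
      also have "\<dots> = 0" using less Suc by (intro sum.neutral) simp
      finally show ?thesis using Suc by (simp del: of_nat_Suc)
    qed (use assms(2) in simp)
  qed
qed

lemma fps_eqI_deriv:
  fixes f g :: "rat fps"
  assumes "fps_deriv f = fps_deriv g" "f $ 0 = g $ 0"
  shows "f = g"
  using fps_linear_ode_zero[of "f - g" 0] assms by simp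

abbreviation "cactus \<equiv> egf (nonseries_trees 1)"

lemma cactus_eq: "cactus = fps_X * (1 + egf (leafless_trees 2))"
  by (simp add: egf_nonseries_1 algebra_simps)

lemma egf_series_2_eq: "2 * egf (series_trees 2) = cactus ^ 2"
proof (rule fps_eqI_deriv)
  show "fps_deriv (2 * egf (series_trees 2)) = fps_deriv (cactus ^ 2)"
    by (simp add: deriv_egf_series_2 power2_eq_square algebra_simps)
qed (simp add: power2_eq_square)

text \<open>The differential form of 1 + L = exp(S): a possibly empty set of series trees of defect
  2 in parallel. Together with \<open>cactus_eq\<close> and \<open>egf_series_2_eq\<close> it
  encodes c = x exp(c^2 / 2).\<close>

lemma deriv_egf_leafless_2: "fps_deriv (egf (leafless_trees 2)) = fps_deriv (egf (series_trees 2)) * (1 + egf (leafless_trees 2))"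
proof -
  have "fps_deriv (egf (leafless_trees 2)) = fps_deriv (egf (series_trees 2)) + fps_deriv (egf (par_of (series_trees 2) (leafless_trees 2)))"
    by (subst egf_leafless_2) simp
  then show ?thesis by (simp add: deriv_egf_par_of algebra_simps)
qed

lemma deriv_cactus: "fps_deriv cactus * (1 - cactus ^ 2) = 1 + egf (leafless_trees 2)"
proof -
  \<comment> \<open>The product rule; by \<open>cactus_eq\<close> the last summand equals
    \<open>fps_deriv cactus * cactus ^ 2\<close>.\<close>
  have "fps_deriv cactus = (1 + egf (leafless_trees 2)) + fps_X * (fps_deriv cactus * cactus * (1 + egf (leafless_trees 2)))"
    by (subst cactus_eq) (simp add: deriv_egf_leafless_2 deriv_egf_series_2)
  then show ?thesis using cactus_eq by algebra
qed

text \<open>The first two terms of the derivative form the product rule for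
  \<open>cactus * egf (nonseries_trees 2)\<close>, and the third is c' c^2 / 2, the derivative of
  c^3 / 6. The factor 6 clears denominators.\<close>

lemma egf_series_3_eq: "6 * egf (series_trees 3) = 6 * (cactus * egf (nonseries_trees 2)) + cactus ^ 3"
proof (rule fps_eqI_deriv)
  have "fps_deriv (6 * egf (series_trees 3)) = 6 * (fps_deriv cactus * egf (nonseries_trees 2) + fps_deriv (egf (nonseries_trees 2)) * cactus)
      + 3 * fps_deriv cactus * (2 * egf (series_trees 2))"
    by (simp add: deriv_egf_series_3 algebra_simps)
  also have "\<dots> = fps_deriv (6 * (cactus * egf (nonseries_trees 2)) + cactus ^ 3)"
    unfolding egf_series_2_eq by (simp add: power2_eq_square power3_eq_cube algebra_simps)
  finally show "fps_deriv (6 * egf (series_trees 3)) = fps_deriv (6 * (cactus * egf (nonseries_trees 2)) + cactus ^ 3)" .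
qed (simp add: power3_eq_cube)

text \<open>Exactly one of the parallel components has defect 3, the others form a set of components
  of defect 2. Formally, the difference of the two sides solves a homogeneous linear equation with
  initial value 0.\<close>

lemma egf_leafless_3_eq: "egf (leafless_trees 3) = egf (series_trees 3) * (1 + egf (leafless_trees 2))"
proof -
  let ?D = "egf (leafless_trees 3) - egf (series_trees 3) * (1 + egf (leafless_trees 2))"
  have "fps_deriv (egf (leafless_trees 3)) = fps_deriv (egf (series_trees 3)) * (1 + egf (leafless_trees 2)) + fps_deriv (egf (series_trees 2)) * egf (leafless_trees 3)"
    by (subst egf_leafless_3) (simp add: deriv_egf_par_of algebra_simps)
  then have "fps_deriv ?D = fps_deriv (egf (series_trees 2)) * ?D"
    by (simp add: deriv_egf_leafless_2 algebra_simps)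
  then have "?D = 0" by (rule fps_linear_ode_zero) simp
  then show ?thesis by simp
qed

text \<open>All other series are eliminated in favour of \<open>cactus\<close>. Writing the result
  with derivatives of powers prepares the extraction of coefficients; 12 is the common denominator
  of c^3 / 3, c^2 / 2 and c^4 / 12.\<close>

lemma egf_leafless_3_cactus:
  "12 * (fps_X * egf (leafless_trees 3)) = 4 * fps_deriv (cactus ^ 3) -
    fps_X * (6 * fps_deriv (cactus ^ 2) + fps_deriv (cactus ^ 4))"
proof -
  \<comment> \<open>Since \<open>fps_X * egf (leafless_trees 3)\<close> equals
    \<open>cactus * egf (series_trees 3)\<close>, the nonseries term feeds the unknown back with the
    factor \<open>cactus ^ 2\<close>.\<close>
  have s: "12 * egf (series_trees 3) * (1 - cactus ^ 2) = 12 * cactus * egf (leafless_trees 2) - 4 * cactus ^ 3"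
    using egf_series_3_eq egf_nonseries_2 egf_leafless_2 egf_series_2_eq cactus_eq egf_leafless_3_eq by algebra
  \<comment> \<open>By \<open>deriv_cactus\<close> the same factor \<open>1 - cactus ^ 2\<close>
    appears here, so no division is required.\<close>
  have "12 * egf (leafless_trees 3) = fps_deriv cactus * (12 * egf (series_trees 3) * (1 - cactus ^ 2))"
    using egf_leafless_3_eq deriv_cactus by algebra
  then have "12 * egf (leafless_trees 3) = fps_deriv cactus * (12 * cactus * egf (leafless_trees 2) - 4 * cactus ^ 3)"
    unfolding s .
  \<comment> \<open>Multiplying by \<open>fps_X\<close> turns \<open>egf (leafless_trees 2)\<close>
    into \<open>cactus - fps_X\<close>.\<close>
  then have "12 * (fps_X * egf (leafless_trees 3)) = 12 * (fps_deriv cactus * cactus ^ 2) -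
      fps_X * (12 * (fps_deriv cactus * cactus) + 4 * (fps_deriv cactus * cactus ^ 3))"
    using cactus_eq by algebra
  moreover have "fps_deriv (cactus ^ 3) = 3 * (fps_deriv cactus * cactus ^ 2)"
    "fps_deriv (cactus ^ 2) = 2 * (fps_deriv cactus * cactus)"
    "fps_deriv (cactus ^ 4) = 4 * (fps_deriv cactus * cactus ^ 3)"
    by (simp_all add: fps_deriv_power' eval_nat_numeral algebra_simps)
  ultimately show ?thesis by simp
qed

text \<open>Multiply x c' (1 - c^2) = c by k (k + 2) c^(k-1); the left side then consists of
  derivatives of c^k and c^(k+2), and x d/dx multiplies the coefficient at \<open>m\<close> by
  \<open>m\<close>.\<close>

lemma cactus_power_recurrence:
  assumes "k > 0"
  shows "of_nat (k + 2) * (of_nat m - of_nat k) * (cactus ^ k) $ m = of_nat k * of_nat m * (cactus ^ (k + 2)) $ m"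
proof -
  have c: "fps_X * fps_deriv cactus * (1 - cactus ^ 2) = cactus"
    unfolding mult.assoc deriv_cactus by (rule cactus_eq[symmetric])
  obtain j where k: "k = Suc j" using assms by (cases k) auto
  have d: "fps_deriv (cactus ^ Suc i) = of_nat (Suc i) * (fps_deriv cactus * cactus ^ i)" for i
    by (simp only: fps_deriv_power' diff_Suc_1 mult.assoc)
  have "of_nat (k + 2) * (fps_X * fps_deriv (cactus ^ k)) - of_nat k * (fps_X * fps_deriv (cactus ^ (k + 2)))
     = of_nat k * of_nat (k + 2) * (fps_X * fps_deriv cactus * (1 - cactus ^ 2)) * cactus ^ j"
  proof -
    have "k + 2 = Suc (Suc (Suc j))" using k by simp
    then show ?thesis unfolding k
      by (simp only: d) (simp add: algebra_simps power2_eq_square del: of_nat_Suc)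
  qed
  also have "\<dots> = of_nat k * of_nat (k + 2) * cactus ^ k"
    unfolding c k by (simp add: mult.assoc)
  finally have "(of_nat (k + 2) * (fps_X * fps_deriv (cactus ^ k)) - of_nat k * (fps_X * fps_deriv (cactus ^ (k + 2)))) $ m
     = (of_nat k * of_nat (k + 2) * cactus ^ k) $ m" by simp
  moreover have "(of_nat i * f) $ m = of_nat i * f $ m" for i and f :: "rat fps"
    by (simp add: fps_of_nat[symmetric])
  moreover have "(fps_X * fps_deriv f) $ m = of_nat m * f $ m" for f :: "rat fps"
    by (cases m) simp_all
  ultimately have "of_nat (k + 2) * (of_nat m * (cactus ^ k) $ m) - of_nat k * (of_nat m * (cactus ^ (k + 2)) $ m)
     = of_nat k * (of_nat (k + 2) * (cactus ^ k) $ m)"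
    by (simp only: fps_sub_nth mult.assoc)
  then show ?thesis by (simp add: algebra_simps)
qed

text \<open>The value that Lagrange inversion gives for c = x exp(c^2 / 2). In the induction the
  index stays fixed: lowering \<open>j\<close> by one raises the power by two, until only the
  leading coefficient 1 remains.\<close>

lemma cactus_power_nth:
  assumes "k > 0"
  shows "(cactus ^ k) $ (k + 2 * j) =
    of_nat k / of_nat (k + 2 * j) * (of_nat (k + 2 * j) / 2) ^ j / fact j"
  using assms
proof (induction j arbitrary: k)
  case 0
  have "cactus ^ k = fps_X ^ k * (1 + egf (leafless_trees 2)) ^ k"
    by (simp add: cactus_eq power_mult_distrib)
  then show ?case using 0 by (simp add: fps_X_power_mult_nth fps_power_zeroth)
next
  case (Suc j)
  let ?m = "of_nat (k + 2 * Suc j) :: rat"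
  have m: "k + 2 * Suc j = (k + 2) + 2 * j" by simp
  have "of_nat (k + 2) * (2 * of_nat (Suc j)) * (cactus ^ k) $ (k + 2 * Suc j)
     = of_nat k * ?m * (cactus ^ (k + 2)) $ (k + 2 * Suc j)"
    using cactus_power_recurrence[OF Suc.prems, of "k + 2 * Suc j"] by simp
  also have "\<dots> = of_nat k * ?m * (of_nat (k + 2) / ?m * (?m / 2) ^ j / fact j)"
    using Suc.IH[of "k + 2"] unfolding m by simp
  finally have "(cactus ^ k) $ (k + 2 * Suc j) = of_nat k * (?m / 2) ^ j / (2 * of_nat (Suc j) * fact j)"
    by (simp add: divide_simps mult_ac del: of_nat_Suc)
  also have "\<dots> = of_nat k / ?m * (?m / 2) ^ Suc j / fact (Suc j)"
    by (simp add: divide_simps del: of_nat_Suc)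
  finally show ?case .
qed

text \<open>The form in which coefficients of derivatives occur; the index cancels the
  denominator.\<close>

lemma index_mult_cactus_power_nth:
  assumes "k > 0"
  shows "of_nat (k + 2 * j) * (cactus ^ k) $ (k + 2 * j) = of_nat k * (of_nat (k + 2 * j) / 2) ^ j / fact j"
  unfolding cactus_power_nth[OF assms] using assms by (simp del: of_nat_add)

text \<open>The even factors of the factorial multiply to 2^j j!.\<close>

lemma fact_odd_double_fact: "fact (2 * j + 1) = double_fact (2 * j + 1) * 2 ^ j * fact j"
  by (induction j) (simp_all add: algebra_simps)

text \<open>Pure algebra with powers and factorials as atoms: \<open>x\<close> is n - 3,
  \<open>p\<close> is (n-1)^(n-3), \<open>f\<close> is (n-3)!, \<open>F\<close> is (2n-3)!,
  \<open>a\<close> is (2n-1)^(n-2) and \<open>t\<close> is 2^(n-2). The first terms coincide, and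
  both remaining pairs add up to a multiple of p (4x + 7).\<close>

lemma closed_forms_agree:
  fixes x p f F a t :: rat
  assumes "x + 1 \<noteq> 0" "x + 2 \<noteq> 0" "f \<noteq> 0"
  shows "F * (a / t / ((x + 1) * f) - (x + 2) * p / ((x + 1) * f) - p / (3 * f))
      = a * (F / (t * ((x + 1) * f)))
      - (x + 1) * (p / (x + 2) ^ 2) * ((2 * x + 5) * (2 * x + 4) * F) / (3 * ((x + 1) * f))
      - (x + 4) * p * F / (3 * ((x + 2) * ((x + 1) * f)))"
proof -
  have "(x + 2) * p / ((x + 1) * f) + p / (3 * f) = p * (4 * x + 7) / (3 * ((x + 1) * f))"
    using assms by (simp add: divide_simps) (simp add: algebra_simps)
  moreover have "(x + 1) * (p / (x + 2) ^ 2) * ((2 * x + 5) * (2 * x + 4) * F) / (3 * ((x + 1) * f))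
      + (x + 4) * p * F / (3 * ((x + 2) * ((x + 1) * f))) = F * (p * (4 * x + 7) / (3 * ((x + 1) * f)))"
    using assms by (simp add: divide_simps power2_eq_square) algebra
  moreover have "F * (a / t / ((x + 1) * f)) = a * (F / (t * ((x + 1) * f)))" by simp
  moreover have "F * (A - B - C) = A' - V - W" if "B + C = D" "V + W = F * D" "F * A = A'"
    for A B C D V W A' :: rat
    unfolding that(3)[symmetric] using that(2) unfolding that(1)[symmetric] by (simp add: algebra_simps)
  ultimately show ?thesis by blast
qed

theorem corollary1p6:
  fixes n :: nat
  assumes "n > 1"
  shows "(of_nat (card (simple_sp_matroids {1..2 * n - 2} n)) :: rat) =
      (2 * of_nat n - 1) ^ (n - 2) * of_nat (double_fact (2 * n - 3))
    - (of_nat n - 2) * (of_nat n - 1) powi (int n - 5) * fact (2 * n - 1) / (3 * fact (n - 2))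
    - (of_nat n + 1) * (of_nat n - 1) powi (int n - 3) * fact (2 * n - 3) / (3 * fact (n - 1))"
proof -
  define m where "m = 2 * n - 3"
  have card: "(of_nat (card (simple_sp_matroids {1..2 * n - 2} n)) :: rat) = fact m * egf (leafless_trees 3) $ m"
    unfolding card_simple_sp_matroids[OF assms] m_def by (simp add: egf_def)
  \<comment> \<open>Multiplication by \<open>fps_X\<close> moves to index \<open>m + 1\<close>. The
    derivative of the cube then reads index \<open>m + 2\<close>, while in the other terms
    \<open>fps_X\<close> undoes the shift of the derivative.\<close>
  have "12 * egf (leafless_trees 3) $ m = (12 * (fps_X * egf (leafless_trees 3))) $ Suc m"
    by (simp add: numeral_fps_const)
  also have "\<dots> = 4 * of_nat (m + 2) * (cactus ^ 3) $ (m + 2) - of_nat (m + 1) *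
      (6 * (cactus ^ 2) $ (m + 1) + (cactus ^ 4) $ (m + 1))"
    unfolding egf_leafless_3_cactus by (simp add: numeral_fps_const algebra_simps)
  finally have coeff: "12 * egf (leafless_trees 3) $ m = 4 * of_nat (m + 2) * (cactus ^ 3) $ (m + 2) - of_nat (m + 1) *
      (6 * (cactus ^ 2) $ (m + 1) + (cactus ^ 4) $ (m + 1))" .
  show ?thesis
  proof (cases "n = 2")
    case True
    then have m: "m = 1" by (simp add: m_def)
    \<comment> \<open>Index 2 lies below the order of the fourth power, outside the range of
      \<open>cactus_power_nth\<close>, so this case stands apart; the count is 0.\<close>
    have "(cactus ^ 4) $ 2 = 0"
      by (simp add: cactus_eq power_mult_distrib fps_X_power_mult_nth)
    moreover have "(cactus ^ 3) $ 3 = 1" "(cactus ^ 2) $ 2 = 1"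
      using cactus_power_nth[of 3 0] cactus_power_nth[of 2 0] by simp_all
    moreover have "1 + 2 = (3::nat)" "1 + 1 = (2::nat)" by simp_all
    note coeff[unfolded m this]
    ultimately have "egf (leafless_trees 3) $ 1 = 0" by simp
    then show ?thesis unfolding card m using True by simp
  next
    case False
    \<comment> \<open>All exponents and factorial arguments become natural numbers in
      \<open>k\<close>, except the exponent n - 5, which is handled as division by
      \<open>(of_nat k + 2) ^ 2\<close>.\<close>
    define k where "k = n - 3"
    have n: "n = k + 3" and m: "m = 2 * k + 3" using assms False by (simp_all add: k_def m_def)
    let ?x = "of_nat k :: rat"
    let ?P = "(?x + 2) ^ k" and ?f = "fact k :: rat" and ?F = "fact (2 * k + 3) :: rat"
    have fk: "fact (k + 1) = (?x + 1) * ?f" by (simp add: algebra_simps)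
    \<comment> \<open>Each index is written as the power plus twice the exponent \<open>j\<close> of
      \<open>cactus_power_nth\<close>; for the fourth power \<open>j\<close> is one smaller than for
      the others.\<close>
    have i: "m + 2 = 3 + 2 * (k + 1)" "m + 1 = 2 + 2 * (k + 1)" "m + 1 = 4 + 2 * k" by (simp_all add: m)
    have o: "of_nat (3 + 2 * (k + 1)) / 2 = (2 * ?x + 5) / 2" "of_nat (2 + 2 * (k + 1)) / 2 = ?x + 2"
      "of_nat (4 + 2 * k) / 2 = ?x + 2" by simp_all
    have c3: "of_nat (m + 2) * (cactus ^ 3) $ (m + 2) = 3 * ((2 * ?x + 5) / 2) ^ (k + 1) / ((?x + 1) * ?f)"
      unfolding i(1) index_mult_cactus_power_nth[OF zero_less_numeral] o fk by simp
    have c2: "of_nat (m + 1) * (cactus ^ 2) $ (m + 1) = 2 * (?x + 2) ^ (k + 1) / ((?x + 1) * ?f)"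
      unfolding i(2) index_mult_cactus_power_nth[OF zero_less_numeral] o fk by simp
    have c4: "of_nat (m + 1) * (cactus ^ 4) $ (m + 1) = 4 * (?x + 2) ^ k / ?f"
      unfolding i(3) index_mult_cactus_power_nth[OF zero_less_numeral] o fk by simp
    have x: "?x + 1 \<noteq> 0" "?x + 2 \<noteq> 0" by linarith+
    have E: "egf (leafless_trees 3) $ m = ((2 * ?x + 5) / 2) ^ (k + 1) / ((?x + 1) * ?f)
        - (?x + 2) ^ (k + 1) / ((?x + 1) * ?f) - ?P / (3 * ?f)"
    proof -
      have "12 * egf (leafless_trees 3) $ m = 4 * (of_nat (m + 2) * (cactus ^ 3) $ (m + 2)) -
          6 * (of_nat (m + 1) * (cactus ^ 2) $ (m + 1)) - of_nat (m + 1) * (cactus ^ 4) $ (m + 1)"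
        unfolding coeff by (simp add: algebra_simps)
      moreover have "4 * (3 * a / d) - 6 * (2 * b / d) - 4 * p / f = 12 * (a / d - b / d - p / (3 * f))"
        for a b d p f :: rat by (simp add: right_diff_distrib)
      ultimately have "12 * egf (leafless_trees 3) $ m = 12 * (((2 * ?x + 5) / 2) ^ (k + 1) / ((?x + 1) * ?f)
        - (?x + 2) ^ (k + 1) / ((?x + 1) * ?f) - ?P / (3 * ?f))"
        unfolding c3 c2 c4 by (rule trans)
      then show ?thesis by (simp only: mult_cancel_left) simp
    qed
    have df: "of_nat (double_fact (2 * n - 3)) = ?F / (2 ^ (k + 1) * ((?x + 1) * ?f))"
    proof -
      have j: "2 * k + 3 = 2 * (k + 1) + 1" "2 * n - 3 = 2 * (k + 1) + 1" using n by simp_all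
      have "?F = of_nat (fact (2 * (k + 1) + 1))" unfolding j(1) by (simp only: of_nat_fact)
      also have "\<dots> = of_nat (double_fact (2 * (k + 1) + 1)) * 2 ^ (k + 1) * fact (k + 1)"
        unfolding fact_odd_double_fact by (simp only: of_nat_mult of_nat_power of_nat_numeral of_nat_fact)
      finally have "?F = of_nat (double_fact (2 * n - 3)) * (2 ^ (k + 1) * ((?x + 1) * ?f))"
        unfolding j(2) fk by (simp only: mult.assoc)
      then show ?thesis using x by (simp add: divide_simps)
    qed
    have pw: "(of_nat n - 1 :: rat) powi (int n - 5) = ?P / (?x + 2) ^ 2"
      "(of_nat n - 1 :: rat) powi (int n - 3) = ?P"
    proof -
      have e: "(of_nat n - 1 :: rat) = ?x + 2" "int n - 5 = int k - 2" "int n - 3 = int k" by (simp_all add: n)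
      show "(of_nat n - 1 :: rat) powi (int n - 5) = ?P / (?x + 2) ^ 2"
        "(of_nat n - 1 :: rat) powi (int n - 3) = ?P"
        unfolding e using x(2) by (simp_all add: power_int_diff)
    qed
    have f: "fact (2 * n - 1) = (2 * ?x + 5) * (2 * ?x + 4) * ?F" "fact (2 * n - 3) = ?F"
      "fact (n - 2) = (?x + 1) * ?f" "fact (n - 1) = (?x + 2) * ((?x + 1) * ?f)"
    proof -
      have "2 * n - 1 = Suc (Suc (2 * k + 3))" "2 * n - 3 = 2 * k + 3" "n - 2 = Suc k" "n - 1 = Suc (Suc k)"
        using n by simp_all
      then show "fact (2 * n - 1) = (2 * ?x + 5) * (2 * ?x + 4) * ?F" "fact (2 * n - 3) = ?F"
        "fact (n - 2) = (?x + 1) * ?f" "fact (n - 1) = (?x + 2) * ((?x + 1) * ?f)"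
        by (simp_all only: fact_Suc of_nat_Suc of_nat_add of_nat_mult of_nat_numeral) (simp_all add: algebra_simps)
    qed
    have t: "(2 * of_nat n - 1 :: rat) ^ (n - 2) = (2 * ?x + 5) ^ (k + 1)" "of_nat n - 2 = ?x + 1" "of_nat n + 1 = ?x + 4"
      by (simp_all add: n add.commute)
    have Fm: "fact m = ?F" by (simp add: m)
    have s: "(?x + 2) ^ (k + 1) = (?x + 2) * ?P" by simp
    show ?thesis
      unfolding card Fm E df pw f t power_divide s using x by (intro closed_forms_agree) simp_all
  qed
qed

end
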